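(* Let $d\ge3$, $0<\alpha\le d$, $1\le q\le\infty$, and let $\gamma\in C^{d+1}([0,1];\mathbb R^d)$ satisfy $\det(\gamma'(t),\dots,\gamma^{(d)}(t))\ne0$ for all $t\in[0,1]$. Fix $C_0>0$. Let $\kappa\in\mathbb R$ and suppose there is a constant $C$ such that $$\|\widehat g\|_{L^q(d\mu)}\le C\,\langle\mu\rangle_\alpha^{1/q}\,\lambda^\kappa\,\|g\|_{L^2(\mathbb R^d)}$$ for all $\lambda>1$, all positive Borel measures $\mu$ supported in $B(0,1)$ with $\langle\mu\rangle_\alpha<\infty$, and all $g\in L^2(\mathbb R^d)$ supported in the $C_0$-neighborhood of $\lambda\gamma([0,1])$. Then, for $\ell\in\{-1,0,\dots,d-1-[d-\alpha]\}$ with $q\in J_\circ(\ell)$, $$\kappa\ge\kappa_\circ(\alpha,q,\ell).$$ In addition, $\kappa\ge\frac{d-\alpha}{4}$ when $d-1\le\alpha\le d$.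
   Context: For $x\ge0$, $[x]$ and $\langle x\rangle$ are the integer and fractional parts. $\langle\mu\rangle_\alpha=\sup_{x\in\mathbb R^d,\,r>0}r^{-\alpha}\mu(B(x,r))$. $\widehat g(x)=\int e^{ix\cdot\xi}g(\xi)\,d\xi$. $\beta_j(a)=([j-a]+1)a+\frac{(j-1-[j-a])(j-[j-a])}{2}$ for $j=1,\dots,d$, $0<a\le j$. The intervals are $J_\circ(-1)=[2\beta_d(\alpha),\infty]$; $J_\circ(\ell)=[2\beta_{d-\ell-1}(\alpha-\ell-1),\,2\beta_{d-\ell}(\alpha-\ell)]$ for $0\le\ell\le d-2-[d-\alpha]$; $J_\circ(\ell)=[1,\,2\beta_{[d-\alpha]+1}(1-\langle d-\alpha\rangle)]$ for $\ell=d-1-[d-\alpha]$. For $q\in J_\circ(\ell)$: $\kappa_\circ(\alpha,q,-1)=\frac12-\frac\alpha q$, and for $0\le\ell\le d-1-[d-\alpha]$, $$\kappa_\circ(\alpha,q,\ell)=\frac12-\frac{\alpha-\ell}{q}+\frac1{d-\ell}\Big(\frac{\beta_{d-\ell}(\alpha-\ell)}{q}-\frac12\Big).$$ (Here $1/q=0$ if $q=\infty$.) *)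

theory Defs
  imports "HOL-Probability.Essential_Supremum"
begin

text \<open>Derivatives on \<open>[0,1]\<close> are taken within \<open>{0..1}\<close>, hence one-sided at the end points; only the
  values of the curve on \<open>{0..1}\<close> matter.\<close>

definition curve_deriv :: "nat \<Rightarrow> (real \<Rightarrow> 'a::real_normed_vector) \<Rightarrow> real \<Rightarrow> 'a" where
  "curve_deriv k \<gamma> = ((\<lambda>f t. vector_derivative f (at t within {0..1})) ^^ k) \<gamma>"

definition C_k_curve :: "nat \<Rightarrow> (real \<Rightarrow> 'a::real_normed_vector) \<Rightarrow> bool" where
  "C_k_curve n \<gamma> \<longleftrightarrow>
     (\<forall>k<n. \<forall>t\<in>{0..1}. curve_deriv k \<gamma> differentiable (at t within {0..1})) \<and>
     continuous_on {0..1} (curve_deriv n \<gamma>)"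

text \<open>\<open>ennpowr x p\<close> is \<open>x\<close> to the power \<open>p\<close>, for \<open>p \<ge> 0\<close>, with the convention that the zeroth
  power is \<open>1\<close> (real \<open>powr\<close> has \<open>0 powr 0 = 0\<close>).\<close>

definition ennpowr :: "ennreal \<Rightarrow> real \<Rightarrow> ennreal" where
  "ennpowr x p = (if p = 0 then 1 else if x = \<infinity> then \<infinity> else ennreal (enn2real x powr p))"

definition Lp_norm :: "'a measure \<Rightarrow> ereal \<Rightarrow> ('a \<Rightarrow> 'b::real_normed_vector) \<Rightarrow> ennreal" where
  "Lp_norm M q f =
     (if q = \<infinity> then esssup M (\<lambda>x. ennreal (norm (f x)))
      else ennpowr (\<integral>\<^sup>+x. ennreal (norm (f x) powr real_of_ereal q) \<partial>M) (1 / real_of_ereal q))"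

definition measure_support :: "'a::topological_space measure \<Rightarrow> 'a set" where
  "measure_support \<mu> = {x. \<forall>U. open U \<and> x \<in> U \<longrightarrow> emeasure \<mu> U > 0}"

definition dim_const :: "real \<Rightarrow> 'a::metric_space measure \<Rightarrow> ennreal" where
  "dim_const \<alpha> \<mu> = (SUP x. SUP r\<in>{0<..}. ennreal (r powr (- \<alpha>)) * emeasure \<mu> (ball x r))"

definition fourier :: "('a::euclidean_space \<Rightarrow> complex) \<Rightarrow> 'a \<Rightarrow> complex" where
  "fourier g x = (LINT \<xi>|lborel. cis (x \<bullet> \<xi>) * g \<xi>)"

definition beta :: "int \<Rightarrow> real \<Rightarrow> real" where
  "beta j a = (of_int \<lfloor>of_int j - a\<rfloor> + 1) * a
     + of_int ((j - 1 - \<lfloor>of_int j - a\<rfloor>) * (j - \<lfloor>of_int j - a\<rfloor>)) / 2"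

text \<open>The intervals are indexed by \<open>-1 \<le> l \<le> d - 1 - \<lfloor>d - \<alpha>\<rfloor>\<close>; the value for any other \<open>l\<close> is
  irrelevant.\<close>

definition J_circ :: "int \<Rightarrow> real \<Rightarrow> int \<Rightarrow> ereal set" where
  "J_circ d \<alpha> l =
     (if l = -1 then {ereal (2 * beta d \<alpha>)..\<infinity>}
      else if 0 \<le> l \<and> l \<le> d - 2 - \<lfloor>of_int d - \<alpha>\<rfloor> then
        {ereal (2 * beta (d - l - 1) (\<alpha> - of_int l - 1))..ereal (2 * beta (d - l) (\<alpha> - of_int l))}
      else if l = d - 1 - \<lfloor>of_int d - \<alpha>\<rfloor> then
        {1..ereal (2 * beta (\<lfloor>of_int d - \<alpha>\<rfloor> + 1) (1 - frac (of_int d - \<alpha>)))}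
      else {})"

text \<open>Here \<open>real_of_ereal (1 / q)\<close> is \<open>0\<close> for \<open>q = \<infinity>\<close>.\<close>

definition kappa_circ :: "int \<Rightarrow> real \<Rightarrow> ereal \<Rightarrow> int \<Rightarrow> real" where
  "kappa_circ d \<alpha> q l =
     (let s = real_of_ereal (1 / q) in
      if l = -1 then 1 / 2 - \<alpha> * s
      else 1 / 2 - (\<alpha> - of_int l) * s
           + 1 / of_int (d - l) * (beta (d - l) (\<alpha> - of_int l) * s - 1 / 2))"

end

theory Submission
  imports Defs "HOL-Analysis.Analysis"
begin

text \<open>Each lower bound comes from testing the estimate on an explicit pair. Take \<open>g\<close> to be the
  indicator of a set \<open>N\<close> near \<open>\<lambda>\<gamma>\<close>, and \<open>\<mu>\<close> to be Lebesgue measure restricted to a set \<open>E\<close> on which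
  the phases \<open>x \<bullet> \<xi>\<close>, \<open>\<xi> \<in> N\<close>, agree up to a common shift and up to multiples of \<open>2\<pi>\<close>. Then nothing
  cancels, the Fourier transform of \<open>g\<close> has modulus at least \<open>\<bar>N\<bar> / 2\<close> on \<open>E\<close>, and the estimate becomes
  \<open>\<bar>N\<bar>\<^sup>1\<^sup>/\<^sup>2 \<lesssim> B\<^sup>1\<^sup>/\<^sup>q \<lambda>\<^sup>\<kappa>\<close>, where \<open>B\<close> is the constant in
  \<open>\<bar>E \<inter> B(x,r)\<bar> \<le> B r\<^sup>\<alpha> \<bar>E\<bar>\<close> (lemma \<open>restriction_estimate_test\<close>).

  The set \<open>N\<close> is always a union of balls of radius \<open>C\<^sub>0\<close> centred at \<open>\<lambda>\<gamma>(mh)\<close>, on the initial arc of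
  length \<open>\<lambda>\<^sup>-\<^sup>\<theta>\<close> in the parameter and with spacing \<open>\<lambda>h \<sim> \<lambda>\<^sup>\<sigma>\<close>, so that \<open>\<bar>N\<bar> \<sim> \<lambda>\<^sup>a\<close> with
  \<open>a = 1 - \<theta> - \<sigma>\<close>. The set \<open>E\<close> is a product in the coordinates \<open>y\<^sub>j = x \<bullet> \<gamma>\<^sup>(\<^sup>j\<^sup>)(0)\<close>, which are linear
  coordinates because the curve is nondegenerate; Taylor's formula at \<open>0\<close> expresses the phase
  through the \<open>y\<^sub>j\<close>, and growth bounds with exponents \<open>w\<^sub>j\<close>, \<open>\<Sum> w\<^sub>j = \<alpha>\<close>, multiply
  (lemma \<open>arc_test\<close>). If \<open>B \<sim> \<lambda>\<^sup>b\<close>, the outcome is \<open>\<kappa> \<ge> a / 2 - b / q\<close>. Two choices suffice.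

  \<^item> Boxes (\<open>box_test\<close>, \<open>kappa_circ_le\<close>). With \<open>\<sigma> = 0\<close>, let \<open>y\<^sub>j\<close> range over an interval of length about
    \<open>\<lambda> powr - a\<^sub>j\<close>, where \<open>a\<^sub>j = max 0 (1 - j\<theta>)\<close>. An interval of length \<open>s\<close> has growth exponent \<open>w\<close> with
    constant \<open>s\<^sup>-\<^sup>w\<close> for any \<open>w \<in> [0,1]\<close>, so it is cheapest to give weight \<open>1\<close> to the longest sides,
    until the total \<open>\<alpha>\<close> is used up. For \<open>\<theta> = 1 / (d - l)\<close> the sum \<open>b = \<Sum> w\<^sub>j a\<^sub>j\<close> evaluates to
    \<open>\<alpha> - l - \<beta>\<^sub>d\<^sub>-\<^sub>l(\<alpha> - l) / (d - l)\<close> and \<open>a / 2 - b / q\<close> is the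
    exponent with index \<open>l\<close>; \<open>\<theta> = 0\<close> gives the index \<open>-1\<close>.

  \<^item> Planks (\<open>plank_test\<close>). On an arc of parameter length \<open>\<lambda>\<^sup>-\<^sup>1\<^sup>/\<^sup>2\<close> the curve \<open>\<lambda>\<gamma>\<close> stays within \<open>O(1)\<close> of
    its tangent line, so only \<open>y\<^sub>1\<close> matters. With \<open>\<sigma> = (\<alpha> - d + 1) / 2\<close> the frequencies form an almost
    arithmetic progression and the phases agree modulo \<open>2\<pi>\<close> on a family of parallel planks of
    thickness \<open>\<lambda>\<^sup>-\<^sup>1\<^sup>/\<^sup>2\<close> and spacing about \<open>\<lambda>\<^sup>-\<^sup>\<sigma>\<close>. This family has \<open>b = 0\<close>, which makes the bound
    \<open>a / 2 = (d - \<alpha>) / 4\<close> independent of \<open>q\<close>.\<close>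

section \<open>Testing the estimate on indicator functions\<close>

lemma emeasure_lborel_bounded:
  fixes S :: "'a::euclidean_space set"
  shows "bounded S \<Longrightarrow> emeasure lborel S = ennreal (measure lborel S)"
  by (metis emeasure_bounded_finite emeasure_eq_ennreal_measure infinity_ennreal_def order_less_irrefl)

text \<open>Up to a unimodular factor the integrand is \<open>cis\<close> of an angle within distance \<open>1 < \<pi> / 3\<close> of \<open>2\<pi>\<int>\<close>,
  hence has real part at least \<open>1 / 2\<close>.\<close>

lemma norm_fourier_indicator_ge:
  fixes N :: "'a::euclidean_space set"
  assumes N: "N \<in> sets borel" "emeasure lborel N < \<infinity>"
    and phase: "\<And>\<xi>. \<xi> \<in> N \<Longrightarrow> \<exists>n::int. \<bar>x \<bullet> (\<xi> - \<xi>\<^sub>0) - 2 * pi * of_int n\<bar> \<le> 1"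
  shows "measure lborel N / 2 \<le> norm (fourier (indicator N) x)"
proof -
  have cos_ge: "1 / 2 \<le> cos (x \<bullet> (\<xi> - \<xi>\<^sub>0))" if \<xi>: "\<xi> \<in> N" for \<xi>
  proof -
    obtain n :: int where n: "\<bar>x \<bullet> (\<xi> - \<xi>\<^sub>0) - 2 * pi * of_int n\<bar> \<le> 1"
      using phase[OF \<xi>] by blast
    define y where "y = x \<bullet> (\<xi> - \<xi>\<^sub>0) - 2 * pi * of_int n"
    have "cos (x \<bullet> (\<xi> - \<xi>\<^sub>0)) = cos (y + 2 * pi * of_int n)"
      by (simp add: y_def)
    also have "\<dots> = cos \<bar>y\<bar>"
      unfolding cos_add cos_int_2pin sin_int_2pin by simp
    also have "\<dots> \<ge> cos (pi / 3)"
      using n pi_gt3 by (intro cos_monotone_0_pi_le) (auto simp: y_def)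
    finally show ?thesis by (simp add: cos_60)
  qed
  have int_N: "integrable lborel (indicator N :: 'a \<Rightarrow> real)"
    using N by (simp add: integrable_indicator_iff)
  have int_F: "integrable lborel (\<lambda>\<xi>. cis (x \<bullet> \<xi>) * indicator N \<xi> :: complex)"
  proof (rule Bochner_Integration.integrable_bound[OF int_N])
    show "(\<lambda>\<xi>. cis (x \<bullet> \<xi>) * indicator N \<xi>) \<in> borel_measurable lborel"
      using N by (intro borel_measurable_times borel_measurable_indicator)
        (auto simp: cis_conv_exp)
  qed (auto simp: norm_mult indicator_def)
  have int_G: "integrable lborel (\<lambda>\<xi>. cis (- (x \<bullet> \<xi>\<^sub>0)) * (cis (x \<bullet> \<xi>) * indicator N \<xi>) :: complex)"
    using int_F by simp
  have "norm (fourier (indicator N) x) = norm (cis (- (x \<bullet> \<xi>\<^sub>0)) * fourier (indicator N) x)"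
    by (simp add: norm_mult)
  also have "cis (- (x \<bullet> \<xi>\<^sub>0)) * fourier (indicator N) x
      = (LINT \<xi>|lborel. cis (- (x \<bullet> \<xi>\<^sub>0)) * (cis (x \<bullet> \<xi>) * indicator N \<xi>))"
    unfolding fourier_def by simp
  also have "norm \<dots> \<ge> Re \<dots>"
    by (rule complex_Re_le_cmod)
  also have "Re (LINT \<xi>|lborel. cis (- (x \<bullet> \<xi>\<^sub>0)) * (cis (x \<bullet> \<xi>) * indicator N \<xi>))
      = (LINT \<xi>|lborel. Re (cis (- (x \<bullet> \<xi>\<^sub>0)) * (cis (x \<bullet> \<xi>) * indicator N \<xi>)))"
    using int_G by (rule integral_Re[symmetric])
  also have "\<dots> \<ge> (LINT \<xi>|lborel. indicator N \<xi> / 2)"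
  proof (rule integral_mono)
    show "integrable lborel (\<lambda>\<xi>. indicator N \<xi> / 2 :: real)"
      using int_N by simp
    show "integrable lborel (\<lambda>\<xi>. Re (cis (- (x \<bullet> \<xi>\<^sub>0)) * (cis (x \<bullet> \<xi>) * indicator N \<xi>)))"
      using int_G by (rule integrable_Re)
    show "indicator N \<xi> / 2 \<le> Re (cis (- (x \<bullet> \<xi>\<^sub>0)) * (cis (x \<bullet> \<xi>) * indicator N \<xi>))" for \<xi>
      using cos_ge[of \<xi>]
      by (auto simp: indicator_def mult.assoc[symmetric] cis_mult inner_diff_right
               simp del: mult.assoc)
  qed
  finally show ?thesis
    using N by simp
qed

lemma Lp_norm_2_indicator:
  assumes "N \<in> sets M" "emeasure M N < \<infinity>"
  shows "Lp_norm M 2 (indicator N :: _ \<Rightarrow> complex) = ennreal (sqrt (measure M N))"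
proof -
  have "(\<lambda>x. ennreal (norm (indicator N x :: complex) powr real_of_ereal 2)) = indicator N"
    by (auto simp: indicator_def)
  then show ?thesis
    using assms
    by (simp add: Lp_norm_def ennpowr_def measure_def powr_half_sqrt less_top)
qed

lemma Lp_norm_restricted_lborel_ge:
  fixes f :: "'a::euclidean_space \<Rightarrow> complex"
  assumes E: "E \<in> sets borel" "0 < emeasure lborel E" "emeasure lborel E < \<infinity>"
    and q: "1 \<le> q" and L: "0 \<le> L" and f: "\<And>x. x \<in> E \<Longrightarrow> L \<le> norm (f x)"
  shows "ennreal (L * measure lborel E powr real_of_ereal (1 / q))
      \<le> Lp_norm (density lborel (indicator E)) q f"
proof (cases "q = \<infinity>")
  case True
  let ?M = "density lborel (indicator E :: 'a \<Rightarrow> ennreal)"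
  have pos: "0 < measure lborel E"
    using E by (simp add: measure_def enn2real_positive_iff)
  have "ennreal L \<le> esssup ?M (\<lambda>x. ennreal (norm (f x)))"
  proof (rule ccontr)
    assume less: "\<not> ?thesis"
    have "AE x in ?M. ennreal (norm (f x)) \<le> esssup ?M (\<lambda>x. ennreal (norm (f x)))"
      by (rule esssup_AE)
    then have "AE x in lborel. x \<in> E \<longrightarrow> ennreal (norm (f x)) \<le> esssup ?M (\<lambda>x. ennreal (norm (f x)))"
      using E by (subst (asm) AE_density) (auto simp: indicator_def split: if_splits)
    then have "AE x in lborel. x \<notin> E"
    proof eventually_elim
      case (elim x)
      then show ?case
        using f[of x] less ennreal_leI order_trans by blast
    qed
    then have "emeasure lborel E = 0"
      using E by (subst (asm) AE_iff_measurable[of E]) auto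
    then show False using E by simp
  qed
  then show ?thesis
    using True pos by (simp add: Lp_norm_def)
next
  case False
  then obtain p where p: "q = ereal p" "1 \<le> p"
    using q by (cases q) auto
  let ?m = "measure lborel E"
  have m: "emeasure lborel E = ennreal ?m" "0 < ?m"
    using E by (auto simp: measure_def enn2real_positive_iff)
  let ?I = "\<integral>\<^sup>+x. ennreal (norm (f x) powr p) \<partial>density lborel (indicator E)"
  have "ennreal (L powr p * ?m) = (\<integral>\<^sup>+x. ennreal (L powr p) * indicator E x \<partial>lborel)"
    using E by (simp add: nn_integral_cmult_indicator m ennreal_mult')
  also have "\<dots> = (\<integral>\<^sup>+x. ennreal (L powr p) * indicator E x \<partial>density lborel (indicator E))"
    using E by (subst nn_integral_density) (auto intro!: nn_integral_cong simp: indicator_def)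
  also have "\<dots> \<le> ?I"
    using p L f by (intro nn_integral_mono) (auto simp: indicator_def intro!: ennreal_leI powr_mono2)
  finally have le: "ennreal (L powr p * ?m) \<le> ?I" .
  have root: "(L powr p * ?m) powr (1 / p) = L * ?m powr (1 / p)"
    using p L m by (simp add: powr_mult powr_powr)
  have "ennreal (L * ?m powr (1 / p)) \<le> ennpowr ?I (1 / p)"
  proof (cases "?I = \<infinity>")
    case False
    then have "L powr p * ?m \<le> enn2real ?I"
      using le m by (cases ?I) auto
    then have "(L powr p * ?m) powr (1 / p) \<le> enn2real ?I powr (1 / p)"
      using p m by (intro powr_mono2) auto
    then show ?thesis
      using False p root by (auto simp: ennpowr_def intro!: ennreal_leI)
  qed (use p in \<open>simp add: ennpowr_def\<close>)
  moreover have "real_of_ereal (1 / q) = 1 / p"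
    using p by (simp add: one_ereal_def)
  ultimately show ?thesis
    using p by (simp add: Lp_norm_def)
qed

text \<open>The assumed inequality with its constant exposed, since the constants of the tests depend on it.\<close>

definition restriction_estimate ::
    "real \<Rightarrow> (real \<Rightarrow> real ^ 'd) \<Rightarrow> real \<Rightarrow> ereal \<Rightarrow> real \<Rightarrow> real \<Rightarrow> bool" where
  "restriction_estimate C0 \<gamma> \<alpha> q \<kappa> C \<longleftrightarrow> C \<ge> 0 \<and>
      (\<forall>lam>1. \<forall>(\<mu> :: (real ^ 'd) measure) (g :: real ^ 'd \<Rightarrow> complex).
         sets \<mu> = sets borel \<and> measure_support \<mu> \<subseteq> ball 0 1 \<and> dim_const \<alpha> \<mu> < \<infinity> \<and>
         g \<in> borel_measurable lborel \<and> Lp_norm lborel 2 g < \<infinity> \<and>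
         (AE \<xi> in lborel. g \<xi> \<noteq> 0 \<longrightarrow> infdist \<xi> ((\<lambda>t. lam *\<^sub>R \<gamma> t) ` {0..1}) < C0)
         \<longrightarrow> Lp_norm \<mu> q (fourier g)
              \<le> ennreal C * ennpowr (dim_const \<alpha> \<mu>) (real_of_ereal (1 / q))
                 * ennreal (lam powr \<kappa>) * Lp_norm lborel 2 g)"

lemma emeasure_restricted_lborel:
  fixes E :: "'a::euclidean_space set"
  assumes "E \<in> sets borel" "A \<in> sets borel"
  shows "emeasure (density lborel (indicator E)) A = emeasure lborel (E \<inter> A)"
  using assms
  by (subst emeasure_density) (auto simp: indicator_inter_arith[symmetric] intro!: nn_integral_indicator)

lemma ennpowr_le_powr:
  assumes "x \<le> ennreal b" "0 < b" "0 \<le> p"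
  shows "ennpowr x p \<le> ennreal (b powr p)"
proof -
  have "enn2real x \<le> b"
    using assms by (metis enn2real_leI less_imp_le)
  moreover have "x \<noteq> \<infinity>"
    using assms by (auto simp: top_unique)
  ultimately show ?thesis
    using assms by (auto simp: ennpowr_def intro!: ennreal_leI powr_mono2)
qed

text \<open>The estimate is homogeneous in \<open>\<mu>\<close>, so restricted Lebesgue measure need not be normalised: the
  factors \<open>\<bar>E\<bar>\<^sup>1\<^sup>/\<^sup>q\<close> on the two sides cancel, and only the ratio \<open>B\<close> of \<open>\<langle>\<mu>\<rangle>\<^sub>\<alpha>\<close> to the total mass is left.\<close>

lemma restriction_estimate_test:
  fixes \<gamma> :: "real \<Rightarrow> real ^ 'd"
  assumes est: "restriction_estimate C0 \<gamma> \<alpha> q \<kappa> C" and q: "1 \<le> q" and lam: "1 < lam"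
    and N: "N \<in> sets borel" "bounded N"
      "\<And>\<xi>. \<xi> \<in> N \<Longrightarrow> infdist \<xi> ((\<lambda>t. lam *\<^sub>R \<gamma> t) ` {0..1}) < C0"
    and E: "E \<in> sets borel" "E \<subseteq> cball 0 (1 / 2)" "0 < emeasure lborel E"
    and growth: "\<And>x r. 0 < r \<Longrightarrow>
      measure lborel (E \<inter> ball x r) \<le> B * r powr \<alpha> * measure lborel E"
    and phase: "\<And>x \<xi>. x \<in> E \<Longrightarrow> \<xi> \<in> N \<Longrightarrow>
      \<exists>n::int. \<bar>x \<bullet> (\<xi> - \<xi>\<^sub>0) - 2 * pi * of_int n\<bar> \<le> 1"
    and B: "0 < B"
  shows "sqrt (measure lborel N) \<le> 2 * C * B powr real_of_ereal (1 / q) * lam powr \<kappa>"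
proof -
  let ?\<mu> = "density lborel (indicator E) :: (real ^ 'd) measure"
  define s where "s = real_of_ereal (1 / q)"
  have s: "0 \<le> s"
    using q by (cases q) (auto simp: s_def one_ereal_def)
  have C: "0 \<le> C"
    using est by (simp add: restriction_estimate_def)
  have finN: "emeasure lborel N < \<infinity>"
    using N emeasure_bounded_finite by blast
  have bE: "bounded E"
    using E bounded_cball bounded_subset by blast
  have finE: "emeasure lborel E < \<infinity>"
    using bE emeasure_bounded_finite by blast
  have mE: "0 < measure lborel E"
    using E finE by (simp add: measure_def enn2real_positive_iff)
  have dim: "dim_const \<alpha> ?\<mu> \<le> ennreal (B * measure lborel E)"
    unfolding dim_const_def
  proof (intro SUP_least)
    fix x :: "real ^ 'd" and r :: real assume "r \<in> {0<..}"
    then have r: "0 < r" by simp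
    have "emeasure ?\<mu> (ball x r) = emeasure lborel (E \<inter> ball x r)"
      using E by (simp add: emeasure_restricted_lborel)
    also have "\<dots> = ennreal (measure lborel (E \<inter> ball x r))"
      using bE by (intro emeasure_lborel_bounded bounded_Int) simp
    also have "\<dots> \<le> ennreal (B * r powr \<alpha> * measure lborel E)"
      using growth[OF r] by (rule ennreal_leI)
    finally have "ennreal (r powr (- \<alpha>)) * emeasure ?\<mu> (ball x r)
        \<le> ennreal (r powr (- \<alpha>)) * ennreal (B * r powr \<alpha> * measure lborel E)"
      by (rule mult_left_mono) simp
    also have "\<dots> = ennreal (B * measure lborel E)"
      using r by (simp add: ennreal_mult'[symmetric] powr_minus field_simps)
    finally show "ennreal (r powr (- \<alpha>)) * emeasure ?\<mu> (ball x r) \<le> ennreal (B * measure lborel E)" .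
  qed
  have supp: "measure_support ?\<mu> \<subseteq> ball 0 1"
  proof
    fix x assume x: "x \<in> measure_support ?\<mu>"
    show "x \<in> ball 0 1"
    proof (rule ccontr)
      assume "x \<notin> ball 0 1"
      then have "x \<in> - cball 0 (1 / 2)" by simp
      then have "0 < emeasure ?\<mu> (- cball 0 (1 / 2))"
        using x unfolding measure_support_def by blast
      moreover have "E \<inter> - cball 0 (1 / 2) = {}" using E by blast
      ultimately show False
        using E by (simp add: emeasure_restricted_lborel)
    qed
  qed
  have g2: "Lp_norm lborel 2 (indicator N :: _ \<Rightarrow> complex) = ennreal (sqrt (measure lborel N))"
    using N finN by (intro Lp_norm_2_indicator) auto
  have "Lp_norm ?\<mu> q (fourier (indicator N))
      \<le> ennreal C * ennpowr (dim_const \<alpha> ?\<mu>) s * ennreal (lam powr \<kappa>)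
        * Lp_norm lborel 2 (indicator N :: _ \<Rightarrow> complex)"
    using est unfolding restriction_estimate_def s_def
  proof (elim conjE allE[of _ lam] impE, goal_cases)
    case 2
    show ?case
    proof (rule mp[OF spec[OF spec[OF 2(2), of ?\<mu>], of "indicator N"]], intro conjI)
      show "dim_const \<alpha> ?\<mu> < \<infinity>"
        using dim by (auto simp: less_top[symmetric] top_unique)
      show "AE \<xi> in lborel. (indicator N \<xi> :: complex) \<noteq> 0
          \<longrightarrow> infdist \<xi> ((\<lambda>t. lam *\<^sub>R \<gamma> t) ` {0..1}) < C0"
        using N(3) by (auto simp: indicator_def)
    qed (use supp N g2 in auto)
  qed (use lam in auto)
  also have "\<dots> \<le> ennreal C * ennreal ((B * measure lborel E) powr s) * ennreal (lam powr \<kappa>)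
        * ennreal (sqrt (measure lborel N))"
    unfolding g2 using dim s B mE by (intro mult_mono ennpowr_le_powr) auto
  also have "\<dots> = ennreal (C * (B * measure lborel E) powr s * lam powr \<kappa> * sqrt (measure lborel N))"
    using C by (simp add: ennreal_mult')
  finally have upper: "Lp_norm ?\<mu> q (fourier (indicator N))
      \<le> ennreal (C * (B * measure lborel E) powr s * lam powr \<kappa> * sqrt (measure lborel N))" .
  have "ennreal (measure lborel N / 2 * measure lborel E powr s)
      \<le> Lp_norm ?\<mu> q (fourier (indicator N))"
    unfolding s_def using E finE q N finN phase
    by (intro Lp_norm_restricted_lborel_ge norm_fourier_indicator_ge) auto
  then have "ennreal (measure lborel N / 2 * measure lborel E powr s)
      \<le> ennreal (C * (B * measure lborel E) powr s * lam powr \<kappa> * sqrt (measure lborel N))"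
    using upper by (rule order_trans)
  then have "measure lborel N / 2 * measure lborel E powr s
      \<le> C * (B * measure lborel E) powr s * lam powr \<kappa> * sqrt (measure lborel N)"
    using C by (subst (asm) ennreal_le_iff) auto
  then have "measure lborel E powr s * (sqrt (measure lborel N) * sqrt (measure lborel N))
      \<le> measure lborel E powr s * (sqrt (measure lborel N) * (2 * C * B powr s * lam powr \<kappa>))"
    using mE B by (simp add: powr_mult field_simps)
  moreover have "0 < measure lborel E powr s" using mE by simp
  ultimately have *: "sqrt (measure lborel N) * sqrt (measure lborel N)
      \<le> sqrt (measure lborel N) * (2 * C * B powr s * lam powr \<kappa>)"
    by (subst (asm) mult_le_cancel_left_pos)
  show ?thesis
  proof (cases "measure lborel N = 0")
    case False
    then have "0 < sqrt (measure lborel N)"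
      by (simp add: measure_nonneg order.not_eq_order_implies_strict)
    with * show ?thesis unfolding s_def[symmetric] by (subst (asm) mult_le_cancel_left_pos)
  qed (use C in simp)
qed

section \<open>Boxes in linear coordinates\<close>

lemma sets_borel_coordinate_box:
  fixes G :: "'d::finite \<Rightarrow> real set"
  assumes "\<And>j. G j \<in> sets borel"
  shows "{y :: real ^ 'd. \<forall>j. y $ j \<in> G j} \<in> sets borel"
proof -
  have "(\<lambda>y :: real ^ 'd. y $ j) -` G j \<inter> space borel \<in> sets borel" for j
    by (rule measurable_sets[OF _ assms]) (auto intro!: borel_measurable_continuous_onI continuous_intros)
  then have "(\<Inter>j. (\<lambda>y :: real ^ 'd. y $ j) -` G j) \<in> sets borel"
    by (intro sets.finite_INT) auto
  also have "(\<Inter>j. (\<lambda>y :: real ^ 'd. y $ j) -` G j) = {y. \<forall>j. y $ j \<in> G j}"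
    by auto
  finally show ?thesis .
qed

lemma bounded_coordinate_box:
  fixes G :: "'d::finite \<Rightarrow> real set"
  assumes "\<And>j. bounded (G j)"
  shows "bounded {y :: real ^ 'd. \<forall>j. y $ j \<in> G j}"
proof -
  obtain K where K: "\<And>j x. x \<in> G j \<Longrightarrow> norm x \<le> K j"
    using assms unfolding bounded_iff by metis
  have "norm y \<le> (\<Sum>j\<in>UNIV. K j)" if "\<forall>j. y $ j \<in> G j" for y :: "real ^ 'd"
  proof -
    have "norm y \<le> (\<Sum>j\<in>UNIV. \<bar>y $ j\<bar>)" by (rule norm_le_l1_cart)
    also have "\<dots> \<le> (\<Sum>j\<in>UNIV. K j)" using K that by (intro sum_mono) auto
    finally show ?thesis .
  qed
  then show ?thesis by (auto simp: bounded_iff)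
qed

text \<open>Lebesgue measure is a product measure; Fubini is applied to the product of the indicators.\<close>

lemma measure_coordinate_box:
  fixes G :: "'d::finite \<Rightarrow> real set"
  assumes G: "\<And>j. G j \<in> sets borel" "\<And>j. bounded (G j)"
  shows "measure lborel {y :: real ^ 'd. \<forall>j. y $ j \<in> G j} = (\<Prod>j\<in>UNIV. measure lborel (G j))"
proof -
  let ?S = "{y :: real ^ 'd. \<forall>j. y $ j \<in> G j}"
  define f where "f b = (indicator (G (axis_index b)) :: real \<Rightarrow> ennreal)" for b :: "real ^ 'd"
  have *: "(\<Prod>b\<in>(Basis :: (real ^ 'd) set). h b) = (\<Prod>j\<in>UNIV. h (axis j 1))" for h :: "real ^ 'd \<Rightarrow> ennreal"
  proof -
    have B: "(Basis :: (real ^ 'd) set) = range (\<lambda>j. axis j 1)"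
      by (auto simp: Basis_vec_def)
    have "inj (\<lambda>j. axis j 1 :: real ^ 'd)" by (auto simp: inj_on_def axis_eq_axis)
    then show ?thesis unfolding B by (simp add: prod.reindex)
  qed
  have "emeasure lborel ?S = (\<integral>\<^sup>+y. indicator ?S y \<partial>lborel)"
    using sets_borel_coordinate_box[of G] G(1) by (intro nn_integral_indicator[symmetric]) simp
  also have "\<dots> = (\<integral>\<^sup>+y. (\<Prod>b\<in>Basis. f b (y \<bullet> b)) \<partial>lborel)"
  proof (rule nn_integral_cong)
    fix y :: "real ^ 'd"
    show "indicator ?S y = (\<Prod>b\<in>Basis. f b (y \<bullet> b))"
      unfolding * f_def
      by (auto simp: inner_axis indicator_def axis_index_axis prod_eq_1_iff)
  qed
  also have "\<dots> = (\<Prod>b\<in>Basis. (\<integral>\<^sup>+t. f b t \<partial>lborel))"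
    using G by (intro nn_integral_lborel_prod) (auto simp: f_def)
  also have "\<dots> = (\<Prod>j\<in>UNIV. emeasure lborel (G j))"
    using G unfolding * f_def by (simp add: axis_index_axis)
  also have "\<dots> = ennreal (\<Prod>j\<in>UNIV. measure lborel (G j))"
  proof -
    have "emeasure lborel (G j) = ennreal (measure lborel (G j))" for j
      using G by (intro emeasure_lborel_bounded)
    then show ?thesis by (simp add: prod_ennreal)
  qed
  finally show ?thesis
    unfolding measure_def[of lborel ?S] by (simp add: prod_nonneg)
qed

text \<open>Uniqueness of Haar measure in disguise: both sides equal
  \<open>\<integral>\<integral> 1\<^sub>S(f x) 1\<^sub>T(y - f x) dx dy\<close>. Integrating first in \<open>y\<close> gives the left-hand side; reflecting
  \<open>x \<mapsto> z - x\<close>, where \<open>f z = y\<close>, exchanges the roles of \<open>S\<close> and \<open>T\<close>. This is how volumes in the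
  coordinates given by a matrix are compared below, where only ratios of volumes enter.\<close>

lemma measure_linear_preimage_proportional:
  fixes f :: "'a::euclidean_space \<Rightarrow> 'b::euclidean_space"
  assumes f: "linear f" "surj f" and S: "S \<in> sets borel" and T: "T \<in> sets borel"
  shows "emeasure lborel (f -` S) * emeasure lborel T = emeasure lborel (f -` T) * emeasure lborel S"
proof -
  have [measurable]: "f \<in> borel_measurable borel"
    using f by (intro borel_measurable_continuous_onI linear_continuous_on) (simp add: linear_linear)
  note [measurable] = S T
  have pre: "emeasure lborel (f -` U) = (\<integral>\<^sup>+x. indicator U (f x) \<partial>lborel)"
    if [measurable]: "U \<in> sets borel" for U
  proof -
    have "f -` U \<inter> space borel \<in> sets borel" by measurable
    then have "emeasure lborel (f -` U) = (\<integral>\<^sup>+x. indicator (f -` U) x \<partial>lborel)"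
      by (intro nn_integral_indicator[symmetric]) simp
    then show ?thesis by (simp add: indicator_vimage)
  qed
  have shift: "(\<integral>\<^sup>+y. indicator U (y - v) \<partial>lborel) = emeasure lborel U"
    if [measurable]: "U \<in> sets borel" for U and v :: 'b
  proof -
    have "emeasure lborel U = (\<integral>\<^sup>+y. indicator U y \<partial>distr lborel borel ((+) (- v)))"
      by (simp add: lborel_distr_plus)
    also have "\<dots> = (\<integral>\<^sup>+y. indicator U (y - v) \<partial>lborel)"
      by (subst nn_integral_distr) auto
    finally show ?thesis ..
  qed
  have swap: "(\<integral>\<^sup>+x. indicator S (f x) * indicator T (y - f x) \<partial>lborel)
      = (\<integral>\<^sup>+x. indicator T (f x) * indicator S (y - f x) \<partial>lborel)" for y
  proof -
    obtain z where z: "y = f z" using f by blast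
    have refl: "(lborel :: 'a measure) = distr lborel borel (\<lambda>x. z - x)"
    proof -
      have "(lborel :: 'a measure) = density (distr lborel borel (\<lambda>x. z + (-1) *\<^sub>R x)) (\<lambda>_. \<bar>-1 :: real\<bar> ^ DIM('a))"
        by (rule lborel_affine) simp
      then show ?thesis by (simp add: density_1)
    qed
    have "(\<integral>\<^sup>+x. indicator S (f x) * indicator T (y - f x) \<partial>lborel)
        = (\<integral>\<^sup>+x. indicator S (f (z - x)) * indicator T (y - f (z - x)) \<partial>lborel)"
      by (subst refl, subst nn_integral_distr) auto
    also have "\<dots> = (\<integral>\<^sup>+x. indicator T (f x) * indicator S (y - f x) \<partial>lborel)"
      using f by (intro nn_integral_cong) (simp add: z linear_diff mult.commute)
    finally show ?thesis .
  qed
  have half: "emeasure lborel (f -` U) * emeasure lborel V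
      = (\<integral>\<^sup>+y. (\<integral>\<^sup>+x. indicator U (f x) * indicator V (y - f x) \<partial>lborel) \<partial>lborel)"
    if [measurable]: "U \<in> sets borel" "V \<in> sets borel" for U V
  proof -
    have "emeasure lborel (f -` U) * emeasure lborel V
        = (\<integral>\<^sup>+x. indicator U (f x) * emeasure lborel V \<partial>lborel)"
      unfolding pre[OF that(1)] by (rule nn_integral_multc[symmetric]) auto
    also have "\<dots> = (\<integral>\<^sup>+x. (\<integral>\<^sup>+y. indicator U (f x) * indicator V (y - f x) \<partial>lborel) \<partial>lborel)"
      by (intro nn_integral_cong) (simp add: nn_integral_cmult shift)
    also have "\<dots> = (\<integral>\<^sup>+y. (\<integral>\<^sup>+x. indicator U (f x) * indicator V (y - f x) \<partial>lborel) \<partial>lborel)"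
      by (rule lborel_pair.Fubini'[symmetric]) measurable
    finally show ?thesis .
  qed
  show ?thesis
    unfolding half[OF S T] half[OF T S] swap ..
qed

lemma matrix_preimage_bounded_borel:
  fixes A :: "real ^ 'd ^ 'd"
  assumes A: "det A \<noteq> 0" and S: "S \<in> sets borel" "bounded S"
  shows "{x. A *v x \<in> S} \<in> sets borel" "bounded {x. A *v x \<in> S}"
proof -
  obtain A' where A': "A ** A' = mat 1" "A' ** A = mat 1"
    using A unfolding invertible_det_nz[symmetric] invertible_def by blast
  have "(\<lambda>x. A *v x) -` S \<inter> space borel \<in> sets borel"
    by (rule measurable_sets[OF _ S(1)])
      (auto intro!: borel_measurable_continuous_onI matrix_vector_mult_linear_continuous_on)
  then show borel: "{x. A *v x \<in> S} \<in> sets borel"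
    by (simp add: vimage_def)
  have "{x. A *v x \<in> S} \<subseteq> (\<lambda>y. A' *v y) ` S"
  proof safe
    fix x assume "A *v x \<in> S"
    moreover have "x = A' *v (A *v x)"
      using A' by (simp add: matrix_vector_mul_assoc)
    ultimately show "x \<in> (\<lambda>y. A' *v y) ` S" by blast
  qed
  then show "bounded {x. A *v x \<in> S}"
    using S by (meson bounded_linear_image bounded_subset matrix_vector_mul_bounded_linear)
qed

lemma measure_matrix_preimage:
  fixes A :: "real ^ 'd ^ 'd"
  assumes A: "det A \<noteq> 0"
  obtains c where "0 < c"
    "\<And>S. S \<in> sets borel \<Longrightarrow> bounded S \<Longrightarrow> measure lborel {x. A *v x \<in> S} = c * measure lborel S"
proof -
  let ?T = "ball 0 1 :: (real ^ 'd) set"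
  let ?P = "\<lambda>S. {x. A *v x \<in> S}"
  obtain A' where A': "A ** A' = mat 1"
    using A unfolding invertible_det_nz[symmetric] invertible_def by blast
  have surj: "surj ((*v) A)"
    using A' by (intro surjI[of _ "(*v) A'"]) (simp add: matrix_vector_mul_assoc)
  have pre: "emeasure lborel (?P S) = ennreal (measure lborel (?P S))"
    if "S \<in> sets borel" "bounded S" for S
    using matrix_preimage_bounded_borel[OF A that] by (intro emeasure_lborel_bounded)
  have "open ((*v) A -` ?T)"
    by (intro open_vimage) (auto simp: matrix_vector_mult_linear_continuous_on)
  then have "open (?P ?T)" by (simp only: vimage_def)
  moreover have "0 \<in> ?P ?T" by simp
  ultimately obtain r where r: "0 < r" "ball 0 r \<subseteq> ?P ?T"
    by (meson openE)
  have "0 < measure lborel (ball 0 r :: (real ^ 'd) set)"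
    using r by (simp add: content_ball_pos)
  also have "\<dots> \<le> measure lborel (?P ?T)"
    using r matrix_preimage_bounded_borel[OF A, of ?T] emeasure_bounded_finite[of "?P ?T"]
    by (intro measure_mono_fmeasurable) (auto simp: fmeasurable_def)
  finally have pT: "0 < measure lborel (?P ?T)" .
  have T: "0 < measure lborel ?T" by (simp add: content_ball_pos)
  show ?thesis
  proof (rule that[of "measure lborel (?P ?T) / measure lborel ?T"])
    show "0 < measure lborel (?P ?T) / measure lborel ?T" using T pT by simp
    fix S :: "(real ^ 'd) set" assume S: "S \<in> sets borel" "bounded S"
    have "emeasure lborel ((*v) A -` S) * emeasure lborel ?T
        = emeasure lborel ((*v) A -` ?T) * emeasure lborel S"
      using S surj by (intro measure_linear_preimage_proportional) auto
    then have "ennreal (measure lborel (?P S) * measure lborel ?T)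
        = ennreal (measure lborel (?P ?T) * measure lborel S)"
      using pre[OF S] pre[of ?T] emeasure_lborel_bounded[OF S(2)] emeasure_lborel_bounded[of ?T]
      by (simp add: vimage_def ennreal_mult')
    then have "measure lborel (?P S) * measure lborel ?T = measure lborel (?P ?T) * measure lborel S"
      by (subst (asm) ennreal_inj) auto
    then show "measure lborel (?P S) = measure lborel (?P ?T) / measure lborel ?T * measure lborel S"
      using T by (simp add: field_simps)
  qed
qed

lemma coordinate_box_preimage:
  fixes A :: "real ^ 'd ^ 'd" and F :: "'d \<Rightarrow> real set"
  assumes A: "det A \<noteq> 0" and F: "\<And>j. F j \<in> sets borel" "\<And>j. bounded (F j)"
    and pos: "\<And>j. 0 < measure lborel (F j)"
  shows "{x. \<forall>j. (A *v x) $ j \<in> F j} \<in> sets borel"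
    and "0 < emeasure lborel {x. \<forall>j. (A *v x) $ j \<in> F j}"
proof -
  obtain c where c: "0 < c"
    "\<And>S. S \<in> sets borel \<Longrightarrow> bounded S \<Longrightarrow> measure lborel {x. A *v x \<in> S} = c * measure lborel S"
    using measure_matrix_preimage[OF A] by blast
  note box = sets_borel_coordinate_box[of F, OF F(1)] bounded_coordinate_box[of F, OF F(2)]
  show "{x. \<forall>j. (A *v x) $ j \<in> F j} \<in> sets borel"
    using matrix_preimage_bounded_borel(1)[OF A box] by simp
  have "0 < c * (\<Prod>j\<in>UNIV. measure lborel (F j))"
    using c(1) pos by (simp add: prod_pos)
  also have "\<dots> = measure lborel {x. \<forall>j. (A *v x) $ j \<in> F j}"
    using c(2)[OF box] measure_coordinate_box[of F, OF F] by simp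
  finally show "0 < emeasure lborel {x. \<forall>j. (A *v x) $ j \<in> F j}"
    using emeasure_lborel_bounded[OF matrix_preimage_bounded_borel(2)[OF A box]] by simp
qed

text \<open>A ball of radius \<open>r\<close> lies in a cube of side \<open>2 L r\<close> in the coordinates \<open>A *v x\<close>, so the bounds for the
  factors multiply and their exponents add up to \<open>\<alpha>\<close>.\<close>

lemma coordinate_box_growth:
  fixes A :: "real ^ 'd ^ 'd" and F :: "'d \<Rightarrow> real set"
  assumes A: "det A \<noteq> 0" and L: "0 < L" "\<And>z j. \<bar>(A *v z) $ j\<bar> \<le> L * norm z"
    and F: "\<And>j. F j \<in> sets borel" "\<And>j. bounded (F j)"
    and growth: "\<And>j y \<rho>. 0 < \<rho> \<Longrightarrow>
      measure lborel (F j \<inter> {y - \<rho>..y + \<rho>}) \<le> Q j * \<rho> powr w j * measure lborel (F j)"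
    and w: "(\<Sum>j\<in>UNIV. w j) = \<alpha>" and r: "0 < r"
  shows "measure lborel ({x. \<forall>j. (A *v x) $ j \<in> F j} \<inter> ball x r)
    \<le> (\<Prod>j\<in>UNIV. Q j) * L powr \<alpha> * r powr \<alpha> * measure lborel {x. \<forall>j. (A *v x) $ j \<in> F j}"
proof -
  define G where "G j = F j \<inter> {(A *v x) $ j - L * r..(A *v x) $ j + L * r}" for j
  have G: "\<And>j. G j \<in> sets borel" "\<And>j. bounded (G j)"
    using F by (auto simp: G_def bounded_Int)
  obtain c where c: "0 < c"
    "\<And>S. S \<in> sets borel \<Longrightarrow> bounded S \<Longrightarrow> measure lborel {x. A *v x \<in> S} = c * measure lborel S"
    using measure_matrix_preimage[OF A] by blast
  have box: "measure lborel {x. \<forall>j. (A *v x) $ j \<in> H j} = (\<Prod>j\<in>UNIV. measure lborel (H j)) * c"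
    "{x. \<forall>j. (A *v x) $ j \<in> H j} \<in> sets borel" "bounded {x. \<forall>j. (A *v x) $ j \<in> H j}"
    if "\<And>j. H j \<in> sets borel" "\<And>j. bounded (H j)" for H
    using matrix_preimage_bounded_borel[OF A sets_borel_coordinate_box bounded_coordinate_box, of H]
      measure_coordinate_box[of H] c(2)[OF sets_borel_coordinate_box bounded_coordinate_box, of H] that
    by auto
  have "measure lborel ({x. \<forall>j. (A *v x) $ j \<in> F j} \<inter> ball x r)
      \<le> measure lborel {x. \<forall>j. (A *v x) $ j \<in> G j}"
  proof (rule measure_mono_fmeasurable)
    show "{x. \<forall>j. (A *v x) $ j \<in> F j} \<inter> ball x r \<subseteq> {x. \<forall>j. (A *v x) $ j \<in> G j}"
    proof safe
      fix z j assume z: "\<forall>j. (A *v z) $ j \<in> F j" "z \<in> ball x r"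
      have "\<bar>(A *v z) $ j - (A *v x) $ j\<bar> = \<bar>(A *v (z - x)) $ j\<bar>"
        by (simp add: matrix_vector_mult_diff_distrib)
      also have "\<dots> \<le> L * norm (z - x)" by (rule L)
      also have "\<dots> \<le> L * r" using z L by (simp add: dist_norm norm_minus_commute)
      finally show "(A *v z) $ j \<in> G j" using z by (auto simp: G_def abs_le_iff)
    qed
    show "{x. \<forall>j. (A *v x) $ j \<in> F j} \<inter> ball x r \<in> sets lborel"
      using box(2)[OF F] by auto
    show "{x. \<forall>j. (A *v x) $ j \<in> G j} \<in> fmeasurable lborel"
      using box(2)[of G, OF G] emeasure_bounded_finite[OF box(3)[of G, OF G]]
      by (simp add: fmeasurable_def)
  qed
  also have "\<dots> = (\<Prod>j\<in>UNIV. measure lborel (G j)) * c"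
    using G by (rule box)
  also have "\<dots> \<le> (\<Prod>j\<in>UNIV. Q j * (L * r) powr w j * measure lborel (F j)) * c"
    using growth L r c(1) by (intro mult_right_mono prod_mono) (auto simp: G_def)
  also have "\<dots> = (\<Prod>j\<in>UNIV. Q j) * (\<Prod>j\<in>UNIV. (L * r) powr w j) * measure lborel {x. \<forall>j. (A *v x) $ j \<in> F j}"
    by (simp add: box(1)[OF F] prod.distrib)
  also have "(\<Prod>j\<in>UNIV. (L * r) powr w j) = (L * r) powr \<alpha>"
    unfolding w[symmetric] using L r by (intro powr_sum[symmetric]) simp
  also have "(L * r) powr \<alpha> = L powr \<alpha> * r powr \<alpha>"
    using L r by (simp only: powr_mult)
  finally show ?thesis
    by (simp only: mult.assoc)
qed

section \<open>Growth of intervals and of periodic unions of intervals\<close>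

text \<open>The minimum of the two lengths is at most their geometric mean with weights \<open>w\<close> and \<open>1 - w\<close>.\<close>

lemma interval_growth:
  fixes c s \<rho> w y :: real
  assumes "0 < c" "0 < s" "0 < \<rho>" "0 \<le> w" "w \<le> 1"
  shows "measure lborel ({- c * s..c * s} \<inter> {y - \<rho>..y + \<rho>})
    \<le> c powr (- w) * s powr (- w) * \<rho> powr w * measure lborel {- c * s..c * s}"
proof -
  let ?m = "measure lborel ({- c * s..c * s} \<inter> {y - \<rho>..y + \<rho>})"
  have cs: "0 < c * s" using assms by simp
  have m1: "?m \<le> 2 * \<rho>"
  proof -
    have "?m \<le> measure lborel {y - \<rho>..y + \<rho>}"
      by (rule measure_mono_fmeasurable) (auto simp: fmeasurable_def emeasure_lborel_Icc_eq)
    then show ?thesis using assms by simp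
  qed
  have m2: "?m \<le> 2 * (c * s)"
  proof -
    have "?m \<le> measure lborel {- c * s..c * s}"
      by (rule measure_mono_fmeasurable) (auto simp: fmeasurable_def emeasure_lborel_Icc_eq)
    then show ?thesis using cs by simp
  qed
  have "?m = ?m powr w * ?m powr (1 - w)"
    by (subst powr_add[symmetric]) simp
  also have "\<dots> \<le> (2 * \<rho>) powr w * (2 * (c * s)) powr (1 - w)"
    using assms(4,5) m1 m2 by (intro mult_mono powr_mono2) auto
  also have "\<dots> = ((2 * \<rho>) / (2 * (c * s))) powr w * (2 * (c * s))"
    using cs assms(3) unfolding powr_diff powr_divide by simp
  also have "(2 * \<rho>) / (2 * (c * s)) = \<rho> / (c * s)"
    by simp
  also have "(\<rho> / (c * s)) powr w = c powr (- w) * s powr (- w) * \<rho> powr w"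
    using cs assms(1-3) unfolding powr_divide powr_mult powr_minus by (simp add: field_simps)
  finally show ?thesis
    using cs by simp
qed

text \<open>The trace of a family of parallel planks on their common normal.\<close>

definition comb :: "real \<Rightarrow> real \<Rightarrow> nat \<Rightarrow> real set" where
  "comb p \<eta> n = (\<Union>i<n. {real i * p..real i * p + \<eta>})"

lemma sets_borel_comb [measurable]: "comb p \<eta> n \<in> sets borel"
  unfolding comb_def by (intro sets.finite_UN) auto

lemma bounded_comb: "bounded (comb p \<eta> n)"
  unfolding comb_def by (intro bounded_UN) auto

lemma measure_comb:
  assumes "0 \<le> \<eta>" "\<eta> < p"
  shows "measure lborel (comb p \<eta> n) = real n * \<eta>"
proof -
  have "measure lborel (comb p \<eta> n) = (\<Sum>i<n. measure lborel {real i * p..real i * p + \<eta>})"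
    unfolding comb_def
  proof (rule measure_finite_Union)
    show "disjoint_family_on (\<lambda>i. {real i * p..real i * p + \<eta>}) {..<n}"
    proof (unfold disjoint_family_on_def, safe del: equalityI)
      fix i j :: nat
      have sep: "real i * p + \<eta> < real j * p" if "i < j" for i j :: nat
      proof -
        have "real i * p + \<eta> < (real i + 1) * p" using assms by (simp add: algebra_simps)
        also have "\<dots> \<le> real j * p" using that assms by (intro mult_right_mono) auto
        finally show ?thesis .
      qed
      assume "i \<noteq> j"
      then show "{real i * p..real i * p + \<eta>} \<inter> {real j * p..real j * p + \<eta>} = {}"
        using sep[of i j] sep[of j i] by (cases "i < j") auto
    qed
  qed (auto simp: emeasure_lborel_Icc_eq)
  then show ?thesis using assms by simp
qed


lemma comb_count:
  assumes p: "0 < p" and \<eta>: "0 \<le> \<eta>" and \<rho>: "0 \<le> \<rho>"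
  shows "measure lborel (comb p \<eta> n \<inter> {y - \<rho>..y + \<rho>}) \<le> ((2 * \<rho> + \<eta>) / p + 1) * \<eta>"
proof -
  define S where "S = {i. i < n \<and> y - \<rho> - \<eta> \<le> real i * p \<and> real i * p \<le> y + \<rho>}"
  have fin: "finite S" by (simp add: S_def)
  have card: "real (card S) \<le> (2 * \<rho> + \<eta>) / p + 1"
  proof (cases "S = {}")
    case False
    have "S \<subseteq> {Min S..Max S}" using fin by auto
    then have "card S \<le> Suc (Max S) - Min S" by (metis card_atLeastAtMost card_mono finite_atLeastAtMost)
    moreover have le: "Min S \<le> Max S" using fin False by simp
    ultimately have "real (card S) \<le> real (Max S) - real (Min S) + 1" by linarith
    moreover have "real (Max S) - real (Min S) \<le> (2 * \<rho> + \<eta>) / p"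
    proof -
      have "(real (Max S) - real (Min S)) * p \<le> 2 * \<rho> + \<eta>"
      using Min_in[OF fin False] Max_in[OF fin False] by (auto simp: S_def algebra_simps)
      then show ?thesis using p by (simp add: pos_le_divide_eq)
    qed
    ultimately show ?thesis by linarith
  qed (use assms in simp)
  have "measure lborel (comb p \<eta> n \<inter> {y - \<rho>..y + \<rho>}) \<le> measure lborel (\<Union>i\<in>S. {real i * p..real i * p + \<eta>})"
  proof (rule measure_mono_fmeasurable)
    show "comb p \<eta> n \<inter> {y - \<rho>..y + \<rho>} \<subseteq> (\<Union>i\<in>S. {real i * p..real i * p + \<eta>})"
    proof
      fix z assume z: "z \<in> comb p \<eta> n \<inter> {y - \<rho>..y + \<rho>}"
      then obtain i where "i < n" "real i * p \<le> z" "z \<le> real i * p + \<eta>"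
        by (auto simp: comb_def)
      with z have "i \<in> S" by (simp add: S_def)
      then show "z \<in> (\<Union>i\<in>S. {real i * p..real i * p + \<eta>})"
        using \<open>real i * p \<le> z\<close> \<open>z \<le> real i * p + \<eta>\<close> by auto
    qed
    have "bounded (\<Union>i\<in>S. {real i * p..real i * p + \<eta>})" using fin by (intro bounded_UN) auto
    moreover have "(\<Union>i\<in>S. {real i * p..real i * p + \<eta>}) \<in> sets borel" using fin by auto
    ultimately show "(\<Union>i\<in>S. {real i * p..real i * p + \<eta>}) \<in> fmeasurable lborel"
      using emeasure_bounded_finite by (auto simp: fmeasurable_def)
  qed auto
  also have "\<dots> \<le> (\<Sum>i\<in>S. measure lborel {real i * p..real i * p + \<eta>})"
    using fin by (intro measure_UNION_le) auto
  also have "\<dots> = real (card S) * \<eta>" using \<eta> by simp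
  also have "\<dots> \<le> ((2 * \<rho> + \<eta>) / p + 1) * \<eta>" using card \<eta> by (rule mult_right_mono)
  finally show ?thesis .
qed

text \<open>A comb looks one-dimensional below the tooth width \<open>\<eta>\<close>, like a single tooth up to the spacing \<open>p\<close>,
  and one-dimensional again beyond that. So the exponent \<open>w\<close> has to be checked only at the scale \<open>\<eta>\<close>
  (the bound on \<open>\<eta> powr (- w)\<close>) and for the density at large scales (the bound on \<open>1 / p\<close>).\<close>

lemma comb_growth:
  fixes \<eta> p w Q \<rho> :: real
  assumes \<eta>: "0 < \<eta>" "\<eta> < p" and w: "0 \<le> w" "w \<le> 1"
    and Q: "1 \<le> Q" "1 / p \<le> Q * real n" "\<eta> powr (- w) \<le> Q * real n" and \<rho>: "0 < \<rho>"
  shows "measure lborel (comb p \<eta> n \<inter> {y - \<rho>..y + \<rho>})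
    \<le> 4 * Q * \<rho> powr w * measure lborel (comb p \<eta> n)"
proof -
  let ?m = "measure lborel (comb p \<eta> n \<inter> {y - \<rho>..y + \<rho>})"
  have p: "0 < p" using \<eta> by simp
  have m0: "measure lborel (comb p \<eta> n) = real n * \<eta>"
    using \<eta> by (simp add: measure_comb)
  consider "\<rho> \<le> \<eta>" | "\<eta> \<le> \<rho>" "\<rho> \<le> 1" | "1 \<le> \<rho>" by linarith
  then have "?m \<le> (4 * Q * real n * \<rho> powr w) * \<eta>"
  proof cases
    case 1
    have "?m \<le> measure lborel {y - \<rho>..y + \<rho>}"
      by (rule measure_mono_fmeasurable) (auto simp: fmeasurable_def emeasure_lborel_Icc_eq sets_borel_comb)
    also have "\<dots> = 2 * (\<rho> powr w * \<rho> powr (1 - w))"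
      using \<rho> by (subst powr_add[symmetric]) simp
    also have "\<dots> \<le> 2 * (\<rho> powr w * \<eta> powr (1 - w))"
      using 1 \<rho> w by (intro mult_left_mono powr_mono2) auto
    also have "\<eta> powr (1 - w) = \<eta> powr (- w) * \<eta>"
      using \<eta> powr_add[of \<eta> "- w" 1] by (simp add: add.commute)
    also have "2 * (\<rho> powr w * (\<eta> powr (- w) * \<eta>)) \<le> 2 * (\<rho> powr w * (Q * real n * \<eta>))"
      using Q \<eta> by (intro mult_left_mono mult_right_mono) auto
    also have "\<dots> \<le> 4 * (\<rho> powr w * (Q * real n * \<eta>))"
      using Q \<eta> by (intro mult_right_mono) auto
    finally show ?thesis by (simp add: mult_ac)
  next
    case 2
    have \<rho>w: "\<rho> \<le> \<rho> powr w"
      using 2 \<rho> w powr_mono'[of w 1 \<rho>] by simp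
    have "?m \<le> ((2 * \<rho> + \<eta>) / p + 1) * \<eta>"
      using p \<eta> \<rho> by (intro comb_count) auto
    also have "\<dots> \<le> (4 * Q * real n * \<rho> powr w) * \<eta>"
    proof (rule mult_right_mono)
      have "(2 * \<rho> + \<eta>) / p \<le> 3 * \<rho> powr w * (1 / p)"
        using 2 \<rho>w p by (simp add: divide_right_mono)
      also have "\<dots> \<le> 3 * \<rho> powr w * (Q * real n)"
        using Q by (intro mult_left_mono) auto
      finally have a: "(2 * \<rho> + \<eta>) / p \<le> 3 * \<rho> powr w * (Q * real n)" .
      have "1 = \<eta> powr w * \<eta> powr (- w)"
        using \<eta> by (subst powr_add[symmetric]) simp
      also have "\<dots> \<le> \<rho> powr w * (Q * real n)"
        using 2 \<eta> w Q by (intro mult_mono powr_mono2) auto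
      finally show "(2 * \<rho> + \<eta>) / p + 1 \<le> 4 * Q * real n * \<rho> powr w"
        using a by (simp add: mult_ac)
    qed (use \<eta> in simp)
    finally show ?thesis .
  next
    case 3
    have "?m \<le> measure lborel (comb p \<eta> n)"
      using emeasure_bounded_finite[OF bounded_comb]
      by (intro measure_mono_fmeasurable) (auto simp: fmeasurable_def sets_borel_comb)
    also have "\<dots> = real n * 1 * \<eta>" using m0 by simp
    also have "\<dots> \<le> real n * (4 * Q * \<rho> powr w) * \<eta>"
    proof -
      have "1 \<le> \<rho> powr w" using 3 w by (simp add: ge_one_powr_ge_zero)
      then have "1 * 1 \<le> (4 * Q) * \<rho> powr w" using Q by (intro mult_mono) auto
      then show ?thesis using \<eta> by (intro mult_right_mono mult_left_mono) auto
    qed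
    finally show ?thesis by (simp only: mult_ac)
  qed
  then show ?thesis unfolding m0 by (simp only: mult_ac)
qed

section \<open>Local geometry of the curve\<close>

lemma has_vector_derivative_curve_deriv:
  assumes "C_k_curve n \<gamma>" "k < n" "t \<in> {0..1}"
  shows "(curve_deriv k \<gamma> has_vector_derivative curve_deriv (Suc k) \<gamma> t) (at t within {0..1})"
proof -
  have "curve_deriv (Suc k) \<gamma> t = vector_derivative (curve_deriv k \<gamma>) (at t within {0..1})"
    by (simp add: curve_deriv_def)
  then show ?thesis
    using assms by (simp add: C_k_curve_def vector_derivative_works[symmetric])
qed

lemma continuous_on_curve_deriv:
  assumes "C_k_curve n \<gamma>" "k \<le> n"
  shows "continuous_on {0..1} (curve_deriv k \<gamma>)"
proof (cases "k = n")
  case False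
  then have "curve_deriv k \<gamma> differentiable_on {0..1}"
    using assms by (auto simp: C_k_curve_def differentiable_on_def)
  then show ?thesis by (rule differentiable_imp_continuous_on)
qed (use assms in \<open>simp add: C_k_curve_def\<close>)

lemma C_k_curve_Suc_imp:
  assumes "C_k_curve (Suc n) \<gamma>"
  shows "C_k_curve n \<gamma>"
  using assms continuous_on_curve_deriv[OF assms, of n] by (simp add: C_k_curve_def)

text \<open>The remainder is taken of order \<open>n\<close> with a bounded \<open>n\<close>-th derivative, so that a bound for \<open>\<bar>x\<bar> t\<^sup>n\<close>
  controls it; the pairing with \<open>x\<close> is what appears in the phase.\<close>

lemma C_k_curve_Taylor:
  fixes \<gamma> :: "real \<Rightarrow> 'a::euclidean_space"
  assumes \<gamma>: "C_k_curve n \<gamma>" and n: "0 < n"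
  obtains K where "0 < K" "\<And>t x. t \<in> {0..1} \<Longrightarrow>
    \<bar>x \<bullet> (\<gamma> t - \<gamma> 0) - (\<Sum>i=1..<n. t ^ i / fact i * (x \<bullet> curve_deriv i \<gamma> 0))\<bar> \<le> K * t ^ n * norm x"
proof -
  have "bounded (curve_deriv n \<gamma> ` {0..1})"
    by (intro compact_imp_bounded compact_continuous_image continuous_on_curve_deriv[OF \<gamma>]) auto
  then obtain K where K: "0 < K" "\<And>s. s \<in> {0..1} \<Longrightarrow> norm (curve_deriv n \<gamma> s) \<le> K"
    by (auto simp: bounded_pos)
  have "\<bar>x \<bullet> (\<gamma> t - \<gamma> 0) - (\<Sum>i=1..<n. t ^ i / fact i * (x \<bullet> curve_deriv i \<gamma> 0))\<bar> \<le> K * t ^ n * norm x"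
    if t: "t \<in> {0..1}" for t x
  proof -
    let ?R = "\<gamma> t - (\<Sum>i<n. ((t - 0) ^ i / fact i) *\<^sub>R curve_deriv i \<gamma> 0)"
    have int: "((\<lambda>s. ((t - s) ^ (n - 1) / fact (n - 1)) *\<^sub>R curve_deriv n \<gamma> s) has_integral ?R) {0..t}"
    proof (rule Taylor_has_integral[OF n])
      show "curve_deriv 0 \<gamma> = \<gamma>" by (simp add: curve_deriv_def)
      show "(curve_deriv m \<gamma> has_vector_derivative curve_deriv (Suc m) \<gamma> s) (at s within {0..t})"
        if "m < n" "0 \<le> s" "s \<le> t" for m s
        using has_vector_derivative_curve_deriv[OF \<gamma> that(1), of s] that(2,3) t
        by (auto elim!: has_vector_derivative_within_subset)
    qed (use t in auto)
    have "norm ?R \<le> K * t ^ (n - 1) * measure lborel (cbox 0 t)"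
    proof (rule has_integral_bound[OF _ int[folded box_real]])
      show "0 \<le> K * t ^ (n - 1)" using K t by simp
      show "norm (((t - s) ^ (n - 1) / fact (n - 1)) *\<^sub>R curve_deriv n \<gamma> s) \<le> K * t ^ (n - 1)"
        if s: "s \<in> cbox 0 t" for s
      proof -
        have "(t - s) ^ (n - 1) / fact (n - 1) \<le> t ^ (n - 1) / 1"
          using s t by (intro frac_le power_mono) auto
        moreover have "0 \<le> (t - s) ^ (n - 1) / fact (n - 1)" using s by simp
        ultimately have "\<bar>(t - s) ^ (n - 1) / fact (n - 1)\<bar> * norm (curve_deriv n \<gamma> s) \<le> t ^ (n - 1) * K"
          using K(2)[of s] s t by (intro mult_mono) auto
        then show ?thesis by (simp add: mult.commute)
      qed
    qed
    also have "\<dots> = K * (t ^ (n - 1) * t)" using t by simp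
    also have "t ^ (n - 1) * t = t ^ n" using n by (simp add: power_eq_if)
    finally have R: "norm ?R \<le> K * t ^ n" .
    have "(\<Sum>i<n. ((t - 0) ^ i / fact i) *\<^sub>R curve_deriv i \<gamma> 0)
        = \<gamma> 0 + (\<Sum>i=1..<n. (t ^ i / fact i) *\<^sub>R curve_deriv i \<gamma> 0)"
    proof -
      have "{..<n} = insert 0 {1..<n}" using n by auto
      then show ?thesis by (simp add: curve_deriv_def)
    qed
    then have "x \<bullet> ?R = x \<bullet> (\<gamma> t - \<gamma> 0) - (\<Sum>i=1..<n. t ^ i / fact i * (x \<bullet> curve_deriv i \<gamma> 0))"
      by (simp add: inner_diff_right inner_add_right inner_sum_right)
    moreover have "\<bar>x \<bullet> ?R\<bar> \<le> norm x * (K * t ^ n)"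
      by (rule order_trans[OF Cauchy_Schwarz_ineq2 mult_left_mono[OF R norm_ge_zero]])
    ultimately show ?thesis by (simp add: mult.commute)
  qed
  then show ?thesis by (rule that[OF K(1)])
qed

text \<open>Near \<open>0\<close> the derivative stays within \<open>\<bar>\<gamma>'(0)\<bar> / 2\<close> of \<open>\<gamma>'(0)\<close>, so \<open>\<gamma>\<close> differs from a linear motion with
  velocity \<open>\<gamma>'(0)\<close> by a map with half that Lipschitz constant.\<close>

lemma C_k_curve_locally_injective:
  fixes \<gamma> :: "real \<Rightarrow> 'a::euclidean_space"
  assumes \<gamma>: "C_k_curve n \<gamma>" and n: "0 < n" and v: "curve_deriv 1 \<gamma> 0 \<noteq> 0"
  obtains c \<tau> where "0 < c" "0 < \<tau>" "\<tau> \<le> 1"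
    "\<And>s t. s \<in> {0..\<tau>} \<Longrightarrow> t \<in> {0..\<tau>} \<Longrightarrow> c * \<bar>s - t\<bar> \<le> norm (\<gamma> s - \<gamma> t)"
proof -
  let ?v = "curve_deriv 1 \<gamma> 0"
  have "continuous_on {0..1} (curve_deriv 1 \<gamma>)"
    using n by (intro continuous_on_curve_deriv[OF \<gamma>]) simp
  moreover have "0 < norm ?v / 2" using v by simp
  ultimately have "\<exists>d>0. \<forall>t\<in>{0..1}. dist t 0 < d \<longrightarrow> dist (curve_deriv 1 \<gamma> t) ?v < norm ?v / 2"
    by (intro continuous_on_iff[THEN iffD1, rule_format]) auto
  then obtain d where d: "0 < d"
    "\<And>t. t \<in> {0..1} \<Longrightarrow> dist t 0 < d \<Longrightarrow> dist (curve_deriv 1 \<gamma> t) ?v < norm ?v / 2"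
    by blast
  define \<tau> where "\<tau> = min 1 (d / 2)"
  have \<tau>: "0 < \<tau>" "\<tau> \<le> 1" "\<tau> < d" using d by (auto simp: \<tau>_def)
  have "norm ?v / 2 * \<bar>s - t\<bar> \<le> norm (\<gamma> s - \<gamma> t)" if st: "s \<in> {0..\<tau>}" "t \<in> {0..\<tau>}" for s t
  proof -
    have "norm (\<gamma> s - \<gamma> t - (s - t) *\<^sub>R ?v) \<le> norm (s - t) * (norm ?v / 2)"
    proof (rule vector_differentiable_bound_linearization[where S = "{0..\<tau>}"])
      show "(\<gamma> has_vector_derivative curve_deriv 1 \<gamma> x) (at x within {0..\<tau>})" if "x \<in> {0..\<tau>}" for x
      proof (rule has_vector_derivative_within_subset)
        show "(\<gamma> has_vector_derivative curve_deriv 1 \<gamma> x) (at x within {0..1})"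
          using has_vector_derivative_curve_deriv[OF \<gamma> n, of x] that \<tau> by (simp add: curve_deriv_def)
      qed (use \<tau> in auto)
      show "closed_segment t s \<subseteq> {0..\<tau>}"
        using st by (auto simp: closed_segment_eq_real_ivl split: if_splits)
      show "norm (curve_deriv 1 \<gamma> x - ?v) \<le> norm ?v / 2" if "x \<in> {0..\<tau>}" for x
        using d(2)[of x] that \<tau> by (simp add: dist_norm)
    qed (use \<tau> in auto)
    moreover have "norm ((s - t) *\<^sub>R ?v) \<le> norm (\<gamma> s - \<gamma> t - (s - t) *\<^sub>R ?v) + norm (\<gamma> s - \<gamma> t)"
      using norm_triangle_ineq2[of "(s - t) *\<^sub>R ?v" "\<gamma> s - \<gamma> t"] by (simp add: norm_minus_commute)
    ultimately have "\<bar>s - t\<bar> * norm ?v \<le> \<bar>s - t\<bar> * (norm ?v / 2) + norm (\<gamma> s - \<gamma> t)"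
      unfolding norm_scaleR real_norm_def by linarith
    then show ?thesis by (simp add: mult.commute)
  qed
  then show ?thesis using that[of "norm ?v / 2" \<tau>] v \<tau> by simp
qed

section \<open>Frequencies spaced along an arc\<close>

lemma measure_separated_balls:
  fixes P :: "nat \<Rightarrow> 'a::euclidean_space"
  assumes r: "0 < r"
    and sep: "\<And>i j. i < M \<Longrightarrow> j < M \<Longrightarrow> i \<noteq> j \<Longrightarrow> 2 * r \<le> dist (P i) (P j)"
  shows "measure lborel (\<Union>i<M. ball (P i) r) = real M * measure lborel (ball (0 :: 'a) r)"
proof -
  have "measure lborel (\<Union>i<M. ball (P i) r) = (\<Sum>i<M. measure lborel (ball (P i) r))"
  proof (rule measure_finite_Union)
    show "disjoint_family_on (\<lambda>i. ball (P i) r) {..<M}"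
      unfolding disjoint_family_on_def
    proof (intro ballI impI)
      fix i j assume "i \<in> {..<M}" "j \<in> {..<M}" "i \<noteq> j"
      then have "r + r \<le> dist (P i) (P j)" using sep[of i j] by simp
      then show "ball (P i) r \<inter> ball (P j) r = {}" by (rule disjoint_ballI)
    qed
    show "emeasure lborel (ball (P i) r) \<noteq> \<infinity>" for i
      using emeasure_lborel_ball_finite[of "P i" r] by simp
  qed auto
  also have "\<dots> = (\<Sum>i<M. measure lborel (ball (0 :: 'a) r))"
    using r by (intro sum.cong refl) (simp add: content_ball)
  finally show ?thesis by simp
qed

text \<open>The requirements on a product set \<open>\<Prod> F\<^sub>j\<close>, in the coordinates \<open>y\<^sub>j = x \<bullet> curve_deriv (e j) \<gamma> 0\<close>, under which it can be
  tested against the frequencies \<open>\<lambda>\<gamma>(mh)\<close>, \<open>h = D \<lambda>\<^sup>\<sigma>\<^sup>-\<^sup>1\<close>, \<open>mh \<le> \<tau> \<lambda>\<^sup>-\<^sup>\<theta>\<close>. The growth bound has exponent \<open>w\<^sub>j\<close> and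
  constant \<open>Q\<^sub>j\<close> in direction \<open>j\<close>. The last four bounds serve in turn to keep \<open>x\<close> in a small ball, to
  control the Taylor remainder, to make the Taylor terms of order two or more small, and to place
  the linear term close to \<open>2\<pi>\<int>\<close>.\<close>

definition admissible_coordinates ::
    "('d::finite \<Rightarrow> nat) \<Rightarrow> real \<Rightarrow> real \<Rightarrow> real \<Rightarrow> real \<Rightarrow> real \<Rightarrow> real \<Rightarrow> real
      \<Rightarrow> ('d \<Rightarrow> real set) \<Rightarrow> ('d \<Rightarrow> real) \<Rightarrow> ('d \<Rightarrow> real) \<Rightarrow> bool" where
  "admissible_coordinates e \<alpha> \<tau> D c lam \<theta> \<sigma> F w Q \<longleftrightarrow>
     (\<forall>j. F j \<in> sets borel \<and> 0 < measure lborel (F j)) \<and>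
     (\<Sum>j\<in>UNIV. w j) = \<alpha> \<and> (\<forall>j. 0 < Q j) \<and>
     (\<forall>j y \<rho>. 0 < \<rho> \<longrightarrow>
        measure lborel (F j \<inter> {y - \<rho>..y + \<rho>}) \<le> Q j * \<rho> powr w j * measure lborel (F j)) \<and>
     (\<forall>j. \<forall>y\<in>F j. \<bar>y\<bar> \<le> 2 * c \<and>
        lam * (lam powr - \<theta>) ^ CARD('d) * \<bar>y\<bar> \<le> 2 * c \<and>
        (2 \<le> e j \<longrightarrow> lam * (lam powr - \<theta>) ^ e j * \<bar>y\<bar> \<le> c) \<and>
        (e j = 1 \<longrightarrow> (\<forall>m. real m * (D * lam powr (\<sigma> - 1)) \<le> \<tau> * lam powr - \<theta> \<longrightarrow>
           (\<exists>n::int. \<bar>lam * (real m * (D * lam powr (\<sigma> - 1))) * y - 2 * pi * of_int n\<bar> \<le> c))))"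

text \<open>The constants \<open>\<tau>\<close>, \<open>D\<close>, \<open>c\<close>, \<open>K\<close> depend on the curve and on the estimate alone, whereas \<open>\<theta>\<close>, \<open>\<sigma>\<close> and the
  set may vary with \<open>\<lambda>\<close>: the spacing constant \<open>D\<close> makes the balls of radius \<open>C\<^sub>0\<close> disjoint, and \<open>c\<close> is so
  small that all phase errors together stay below \<open>1\<close>.\<close>

lemma arc_test:
  fixes \<gamma> :: "real \<Rightarrow> real ^ 'd" and e :: "'d \<Rightarrow> nat"
  assumes d: "2 \<le> CARD('d)" and \<gamma>: "C_k_curve (CARD('d)) \<gamma>"
    and e: "bij_betw e UNIV {1..CARD('d)}"
    and det: "det (\<chi> i j. curve_deriv (e j) \<gamma> 0 $ i) \<noteq> 0"
    and C0: "0 < C0"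
    and est: "restriction_estimate C0 \<gamma> \<alpha> q \<kappa> C" and q: "1 \<le> q"
  obtains \<tau> D c K where "0 < \<tau>" "\<tau> \<le> 1" "0 < D" "0 < c" "0 \<le> K"
    "\<And>lam \<theta> \<sigma> F w Q. 1 < lam \<Longrightarrow> 0 \<le> \<theta> \<Longrightarrow> 0 \<le> \<sigma> \<Longrightarrow>
      admissible_coordinates e \<alpha> \<tau> D c lam \<theta> \<sigma> F w Q \<Longrightarrow>
      lam powr ((1 - \<theta> - \<sigma>) / 2)
        \<le> K * (\<Prod>j\<in>UNIV. Q j) powr real_of_ereal (1 / q) * lam powr \<kappa>"
proof -
  define A where "A = (\<chi> j i. curve_deriv (e j) \<gamma> 0 $ i)"
  have "A = transpose (\<chi> i j. curve_deriv (e j) \<gamma> 0 $ i)"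
    by (simp add: A_def transpose_def)
  then have detA: "det A \<noteq> 0" using det by (simp add: det_transpose)
  have A: "(A *v x) $ j = x \<bullet> curve_deriv (e j) \<gamma> 0" for x j
    by (simp add: A_def matrix_vector_mult_def inner_vec_def mult.commute)
  obtain j1 where j1: "e j1 = 1"
    using e d by (metis atLeastAtMost_iff bij_betw_iff_bijections le_refl one_le_numeral order_trans)
  have v: "curve_deriv 1 \<gamma> 0 \<noteq> 0"
  proof
    assume "curve_deriv 1 \<gamma> 0 = 0"
    then have "row j1 A = 0" by (simp add: row_def A_def j1 vec_eq_iff)
    then show False using detA det_zero_row(2) by blast
  qed
  obtain b where b: "0 < b" "\<And>x. b * norm x \<le> norm (A *v x)"
    using linear_inj_bounded_below_pos[of "(*v) A"] detA
    by (metis inj_matrix_vector_mult invertible_det_nz matrix_vector_mul_linear mult.commute)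
  obtain L where L: "0 < L" "\<And>z. norm (A *v z) \<le> norm z * L"
    using bounded_linear.pos_bounded[OF matrix_vector_mul_bounded_linear[of A]] by blast
  have L': "\<bar>(A *v z) $ j\<bar> \<le> L * norm z" for z j
    using component_le_norm_cart[of "A *v z" j] L(2)[of z] by (simp add: mult.commute)
  obtain K\<^sub>T where K\<^sub>T: "0 < K\<^sub>T" "\<And>t x. t \<in> {0..1} \<Longrightarrow>
    \<bar>x \<bullet> (\<gamma> t - \<gamma> 0) - (\<Sum>i=1..<CARD('d). t ^ i / fact i * (x \<bullet> curve_deriv i \<gamma> 0))\<bar>
      \<le> K\<^sub>T * t ^ CARD('d) * norm x"
    using C_k_curve_Taylor[OF \<gamma>] d by auto
  obtain a \<tau> where a: "0 < a" and \<tau>: "0 < \<tau>" "\<tau> \<le> 1"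
    and sep: "\<And>s t. s \<in> {0..\<tau>} \<Longrightarrow> t \<in> {0..\<tau>} \<Longrightarrow> a * \<bar>s - t\<bar> \<le> norm (\<gamma> s - \<gamma> t)"
    using C_k_curve_locally_injective[OF \<gamma> _ v] d by auto
  define dd where "dd = real CARD('d)"
  have dd: "0 < dd" using d by (simp add: dd_def)
  define D where "D = 2 * C0 / a"
  \<comment> \<open>The summands of \<open>W\<close> account for the linear term, the other Taylor terms, the Taylor remainder,
    the radius of the balls, and the requirement that the test set lies in the ball of radius \<open>1 / 2\<close>.\<close>
  define W where "W = 1 + dd + 2 * K\<^sub>T * dd / b + 2 * C0 * dd / b + 4 * dd / b"
  define c where "c = 1 / W"
  define V where "V = measure lborel (ball (0 :: real ^ 'd) C0)"
  define s where "s = real_of_ereal (1 / q)"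
  define K where "K = 2 * C * (L powr \<alpha>) powr s / sqrt (\<tau> / D * V)"
  have D: "0 < D" using a C0 by (simp add: D_def)
  have W: "1 \<le> W" using dd b K\<^sub>T C0 by (simp add: W_def)
  have c: "0 < c" using W by (simp add: c_def)
  have V: "0 < V" using C0 by (simp add: V_def content_ball_pos)
  have C: "0 \<le> C" using est by (simp add: restriction_estimate_def)
  have K: "0 \<le> K" using C \<tau> D V by (simp add: K_def)
  have cW: "c * (1 + dd) + 2 * K\<^sub>T * dd / b * c + 2 * C0 * dd / b * c + 4 * dd / b * c = 1"
  proof -
    have "c * W = 1" using W by (simp add: c_def)
    then show ?thesis unfolding W_def by (simp add: distrib_left mult_ac)
  qed
  have cpos: "0 \<le> c * (1 + dd)" "0 \<le> 2 * K\<^sub>T * dd / b * c" "0 \<le> 2 * C0 * dd / b * c" "0 \<le> 4 * dd / b * c"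
    using c dd b K\<^sub>T C0 by simp_all
  show ?thesis
  proof (rule that[OF \<tau> D c K])
    fix lam \<theta> \<sigma> :: real and F :: "'d \<Rightarrow> real set" and w Q :: "'d \<Rightarrow> real"
    assume lam: "1 < lam" and \<theta>: "0 \<le> \<theta>" and \<sigma>: "0 \<le> \<sigma>"
      and adm: "admissible_coordinates e \<alpha> \<tau> D c lam \<theta> \<sigma> F w Q"
    then have F: "\<And>j. F j \<in> sets borel" "\<And>j. 0 < measure lborel (F j)"
      and w: "(\<Sum>j\<in>UNIV. w j) = \<alpha>" and Q: "\<And>j. 0 < Q j"
      and growth: "\<And>j y \<rho>. 0 < \<rho> \<Longrightarrow>
        measure lborel (F j \<inter> {y - \<rho>..y + \<rho>}) \<le> Q j * \<rho> powr w j * measure lborel (F j)"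
      and F2c: "\<And>j y. y \<in> F j \<Longrightarrow> \<bar>y\<bar> \<le> 2 * c"
      and Fd: "\<And>j y. y \<in> F j \<Longrightarrow> lam * (lam powr - \<theta>) ^ CARD('d) * \<bar>y\<bar> \<le> 2 * c"
      and Fe: "\<And>j y. y \<in> F j \<Longrightarrow> 2 \<le> e j \<Longrightarrow> lam * (lam powr - \<theta>) ^ e j * \<bar>y\<bar> \<le> c"
      and F1: "\<And>j y m. y \<in> F j \<Longrightarrow> e j = 1 \<Longrightarrow> real m * (D * lam powr (\<sigma> - 1)) \<le> \<tau> * lam powr - \<theta> \<Longrightarrow>
        \<exists>n::int. \<bar>lam * (real m * (D * lam powr (\<sigma> - 1))) * y - 2 * pi * of_int n\<bar> \<le> c"
      unfolding admissible_coordinates_def by simp_all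
    define h where "h = D * lam powr (\<sigma> - 1)"
    define T where "T = lam powr - \<theta>"
    define M where "M = nat \<lfloor>\<tau> * T / h\<rfloor> + 1"
    define P where "P m = lam *\<^sub>R \<gamma> (real m * h)" for m
    define N where "N = (\<Union>m<M. ball (P m) C0)"
    define E where "E = {x. \<forall>j. (A *v x) $ j \<in> F j}"
    have h: "0 < h" using D lam by (simp add: h_def)
    have T: "0 < T" "T \<le> 1"
      using lam \<theta> by (simp_all add: T_def powr_le_one_le powr_minus inverse_le_1_iff ge_one_powr_ge_zero)
    have \<tau>T: "\<tau> * T \<le> \<tau>" "\<tau> * T \<le> T"
      using \<tau> T by (simp_all add: mult_left_le mult_left_le_one_le)
    have mh: "real m * h \<le> \<tau> * T" if "m < M" for m
    proof -
      have "0 \<le> \<lfloor>\<tau> * T / h\<rfloor>" using \<tau> T h by simp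
      then have "real m \<le> real_of_int \<lfloor>\<tau> * T / h\<rfloor>" using that unfolding M_def by linarith
      also have "\<dots> \<le> \<tau> * T / h" by simp
      finally show ?thesis using h by (simp add: pos_le_divide_eq)
    qed
    have mh01: "real m * h \<in> {0..\<tau>}" "real m * h \<in> {0..1}" "real m * h \<le> T" if "m < M" for m
      using order_trans[OF mh[OF that] \<tau>T(1)] order_trans[OF mh[OF that] \<tau>T(2)] h \<tau> by auto
    have M: "\<tau> * T / h \<le> real M" using \<tau> T h unfolding M_def by linarith
    have sepP: "2 * C0 \<le> dist (P i) (P j)" if "i < M" "j < M" "i \<noteq> j" for i j
    proof -
      have "1 \<le> \<bar>real i - real j\<bar>" using that(3) by linarith
      then have "h \<le> \<bar>real i * h - real j * h\<bar>"
        using h by (simp add: left_diff_distrib[symmetric] abs_mult)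
      then have "a * h \<le> a * \<bar>real i * h - real j * h\<bar>" using a by simp
      also have "\<dots> \<le> norm (\<gamma> (real i * h) - \<gamma> (real j * h))"
        using mh01 that by (intro sep) auto
      finally have "lam * (a * h) \<le> dist (P i) (P j)"
        using lam by (simp add: P_def dist_norm scaleR_diff_right[symmetric])
      moreover have "lam * (a * h) = 2 * C0 * lam powr \<sigma>"
        using a lam by (simp add: h_def D_def powr_diff)
      moreover have "1 \<le> lam powr \<sigma>" using lam \<sigma> by (simp add: ge_one_powr_ge_zero)
      then have "2 * C0 * 1 \<le> 2 * C0 * lam powr \<sigma>" using C0 by (intro mult_left_mono) auto
      ultimately show ?thesis by simp
    qed
    have mN: "measure lborel N = real M * V"
      unfolding N_def V_def by (rule measure_separated_balls[OF C0 sepP])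
    have bF: "bounded (F j)" for j
      unfolding bounded_iff using F2c[of _ j] by auto
    have sumF: "norm x \<le> (\<Sum>j\<in>UNIV. \<bar>(A *v x) $ j\<bar>) / b" for x
      using b norm_le_l1_cart[of "A *v x"] order_trans by (simp add: pos_le_divide_eq mult.commute) blast
    have normE: "norm x \<le> 2 * dd * c / b" if "x \<in> E" for x
    proof -
      have "(\<Sum>j\<in>UNIV. \<bar>(A *v x) $ j\<bar>) \<le> (\<Sum>j\<in>(UNIV :: 'd set). 2 * c)"
        using that F2c by (intro sum_mono) (auto simp: E_def)
      also have "\<dots> = 2 * dd * c" by (simp add: dd_def)
      finally show ?thesis using sumF[of x] b by (meson divide_right_mono less_imp_le order_trans)
    qed
    have normE': "lam * T ^ CARD('d) * norm x \<le> 2 * dd * c / b" if "x \<in> E" for x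
    proof -
      have "lam * T ^ CARD('d) * norm x \<le> lam * T ^ CARD('d) * ((\<Sum>j\<in>UNIV. \<bar>(A *v x) $ j\<bar>) / b)"
        using sumF lam T by (intro mult_left_mono) auto
      also have "\<dots> = (\<Sum>j\<in>UNIV. lam * T ^ CARD('d) * \<bar>(A *v x) $ j\<bar>) / b"
        by (simp add: sum_distrib_left)
      also have "\<dots> \<le> (\<Sum>j\<in>(UNIV :: 'd set). 2 * c) / b"
        using that Fd b by (intro divide_right_mono sum_mono) (auto simp: E_def T_def)
      also have "\<dots> = 2 * dd * c / b" by (simp add: dd_def)
      finally show ?thesis .
    qed
    have phase: "\<exists>n::int. \<bar>x \<bullet> (\<xi> - lam *\<^sub>R \<gamma> 0) - 2 * pi * of_int n\<bar> \<le> 1"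
      if x: "x \<in> E" and \<xi>: "\<xi> \<in> N" for x \<xi>
    proof -
      obtain m where m: "m < M" "dist (P m) \<xi> < C0" using \<xi> by (auto simp: N_def)
      define t where "t = real m * h"
      have t: "t \<in> {0..1}" "t \<le> T" using mh01[OF m(1)] by (simp_all add: t_def)
      have xe: "x \<bullet> curve_deriv (e j) \<gamma> 0 \<in> F j" for j
        using x unfolding E_def A[symmetric] by blast
      obtain n :: int where n: "\<bar>lam * t * (x \<bullet> curve_deriv 1 \<gamma> 0) - 2 * pi * of_int n\<bar> \<le> c"
        using F1[OF xe[of j1] j1, of m] mh[OF m(1)] unfolding j1 h_def T_def t_def by blast
      define S where "S = (\<Sum>i=1..<CARD('d). t ^ i / fact i * (x \<bullet> curve_deriv i \<gamma> 0))"
      define S' where "S' = (\<Sum>i=2..<CARD('d). t ^ i / fact i * (x \<bullet> curve_deriv i \<gamma> 0))"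
      have "{1..<CARD('d)} = insert 1 {2..<CARD('d)}" using d by auto
      then have S: "S = t * (x \<bullet> curve_deriv 1 \<gamma> 0) + S'"
        by (simp add: S_def S'_def)
      have S': "\<bar>lam * S'\<bar> \<le> dd * c"
      proof -
        have "\<bar>lam * S'\<bar> \<le> (\<Sum>i=2..<CARD('d). \<bar>lam * (t ^ i / fact i * (x \<bullet> curve_deriv i \<gamma> 0))\<bar>)"
          unfolding S'_def sum_distrib_left by (rule sum_abs)
        also have "\<dots> \<le> (\<Sum>i=2..<CARD('d). c)"
        proof (rule sum_mono)
          fix i assume i: "i \<in> {2..<CARD('d)}"
          then have "i \<in> e ` UNIV" using e by (auto simp: bij_betw_def)
          then obtain j where j: "e j = i" by blast
          have "t ^ i / fact i \<le> T ^ i / 1"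
            using t by (intro frac_le power_mono) auto
          then have "lam * (t ^ i / fact i) * \<bar>x \<bullet> curve_deriv i \<gamma> 0\<bar>
              \<le> lam * T ^ i * \<bar>x \<bullet> curve_deriv i \<gamma> 0\<bar>"
            using lam by (intro mult_right_mono mult_left_mono) auto
          also have "\<dots> \<le> c"
            using Fe[OF xe[of j]] i unfolding j T_def by simp
          finally show "\<bar>lam * (t ^ i / fact i * (x \<bullet> curve_deriv i \<gamma> 0))\<bar> \<le> c"
            using lam t by (simp add: abs_mult mult.assoc)
        qed
        also have "\<dots> \<le> dd * c" using c by (simp add: dd_def)
        finally show ?thesis .
      qed
      have R: "\<bar>lam * (x \<bullet> (\<gamma> t - \<gamma> 0)) - lam * S\<bar> \<le> 2 * K\<^sub>T * dd / b * c"
      proof -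
        have "\<bar>lam * (x \<bullet> (\<gamma> t - \<gamma> 0)) - lam * S\<bar> = lam * \<bar>x \<bullet> (\<gamma> t - \<gamma> 0) - S\<bar>"
          using lam by (simp add: right_diff_distrib[symmetric] abs_mult)
        also have "\<dots> \<le> lam * (K\<^sub>T * t ^ CARD('d) * norm x)"
          using K\<^sub>T(2)[OF t(1), of x] lam unfolding S_def by (intro mult_left_mono) auto
        also have "\<dots> \<le> lam * (K\<^sub>T * T ^ CARD('d) * norm x)"
          using K\<^sub>T(1) lam t by (intro mult_left_mono mult_right_mono power_mono) auto
        also have "\<dots> = K\<^sub>T * (lam * T ^ CARD('d) * norm x)" by simp
        also have "\<dots> \<le> K\<^sub>T * (2 * dd * c / b)"
          using K\<^sub>T(1) normE'[OF x] by (intro mult_left_mono) auto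
        finally show ?thesis by (simp add: mult_ac)
      qed
      have \<eta>: "\<bar>x \<bullet> (\<xi> - P m)\<bar> \<le> 2 * C0 * dd / b * c"
      proof -
        have "\<bar>x \<bullet> (\<xi> - P m)\<bar> \<le> norm x * norm (\<xi> - P m)" by (rule Cauchy_Schwarz_ineq2)
        also have "\<dots> \<le> (2 * dd * c / b) * C0"
          using normE[OF x] order_trans[OF norm_ge_zero normE[OF x]] m(2) C0 by (intro mult_mono) (auto simp: dist_norm norm_minus_commute)
        finally show ?thesis by (simp add: mult_ac)
      qed
      \<comment> \<open>The four groups are bounded by the corresponding summands of \<open>c * W = 1\<close>.\<close>
      have "x \<bullet> (\<xi> - lam *\<^sub>R \<gamma> 0) - 2 * pi * of_int n
          = x \<bullet> (\<xi> - P m) + (lam * (x \<bullet> (\<gamma> t - \<gamma> 0)) - lam * S) + lam * S'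
            + (lam * t * (x \<bullet> curve_deriv 1 \<gamma> 0) - 2 * pi * of_int n)"
        unfolding S by (simp add: P_def t_def[symmetric] inner_diff_right distrib_left right_diff_distrib)
      moreover have "c * (1 + dd) = c + dd * c" by (simp add: distrib_left)
      ultimately have "\<bar>x \<bullet> (\<xi> - lam *\<^sub>R \<gamma> 0) - 2 * pi * of_int n\<bar> \<le> 1"
        using n S' R \<eta> cW cpos(4) by linarith
      then show ?thesis by blast
    qed
    have "sqrt (measure lborel N)
        \<le> 2 * C * ((\<Prod>j\<in>UNIV. Q j) * L powr \<alpha>) powr real_of_ereal (1 / q) * lam powr \<kappa>"
    proof (rule restriction_estimate_test[OF est q lam])
      show "N \<in> sets borel" unfolding N_def by auto
      show "bounded N" unfolding N_def by (intro bounded_UN) auto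
      show "infdist \<xi> ((\<lambda>t. lam *\<^sub>R \<gamma> t) ` {0..1}) < C0" if \<xi>: "\<xi> \<in> N" for \<xi>
      proof -
        obtain m where m: "m < M" "dist (P m) \<xi> < C0" using \<xi> by (auto simp: N_def)
        have "infdist \<xi> ((\<lambda>t. lam *\<^sub>R \<gamma> t) ` {0..1}) \<le> dist \<xi> (P m)"
          unfolding P_def using mh01(2)[OF m(1)] by (intro infdist_le) auto
        then show ?thesis using m(2) by (simp add: dist_commute)
      qed
      show "E \<in> sets borel" "0 < emeasure lborel E"
        unfolding E_def by (rule coordinate_box_preimage[OF detA F(1) bF F(2)])+
      show "E \<subseteq> cball 0 (1 / 2)"
      proof
        fix x assume "x \<in> E"
        then have "norm x \<le> 2 * dd * c / b" by (rule normE)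
        also have "\<dots> \<le> 1 / 2" using cW cpos by (simp add: mult_ac)
        finally show "x \<in> cball 0 (1 / 2)" by simp
      qed
      show "measure lborel (E \<inter> ball x r)
          \<le> (\<Prod>j\<in>UNIV. Q j) * L powr \<alpha> * r powr \<alpha> * measure lborel E" if "0 < r" for x r
        unfolding E_def by (rule coordinate_box_growth[OF detA L(1) L' F(1) bF growth w that])
      show "0 < (\<Prod>j\<in>UNIV. Q j) * L powr \<alpha>"
        using Q L by (simp add: prod_pos)
    qed (rule phase)
    also have "((\<Prod>j\<in>UNIV. Q j) * L powr \<alpha>) powr real_of_ereal (1 / q)
        = (\<Prod>j\<in>UNIV. Q j) powr s * (L powr \<alpha>) powr s"
      unfolding s_def by (rule powr_mult)
    finally have up: "sqrt (measure lborel N)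
        \<le> 2 * C * ((\<Prod>j\<in>UNIV. Q j) powr s * (L powr \<alpha>) powr s) * lam powr \<kappa>" .
    have Th: "\<tau> * T / h = \<tau> / D * lam powr (1 - \<theta> - \<sigma>)"
      using lam D by (simp add: T_def h_def powr_diff powr_minus powr_add field_simps)
    have "sqrt (\<tau> / D * V) * lam powr ((1 - \<theta> - \<sigma>) / 2) = sqrt (\<tau> / D * V * lam powr (1 - \<theta> - \<sigma>))"
    proof -
      have "sqrt (lam powr (1 - \<theta> - \<sigma>)) = lam powr ((1 - \<theta> - \<sigma>) / 2)"
        by (simp add: powr_half_sqrt[symmetric] powr_powr)
      then show ?thesis by (simp only: real_sqrt_mult)
    qed
    also have "\<dots> = sqrt ((\<tau> * T / h) * V)" unfolding Th by (simp add: mult_ac)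
    also have "\<dots> \<le> sqrt (measure lborel N)"
      unfolding mN using M V by (intro real_sqrt_le_mono mult_right_mono) auto
    also note up
    finally show "lam powr ((1 - \<theta> - \<sigma>) / 2)
        \<le> K * (\<Prod>j\<in>UNIV. Q j) powr real_of_ereal (1 / q) * lam powr \<kappa>"
      unfolding K_def s_def[symmetric] using \<tau> D V by (simp add: field_simps)
  qed
qed

section \<open>Anisotropic boxes\<close>

lemma powr_le_powr_imp_exponent_le:
  fixes a b K :: real
  assumes K: "0 \<le> K" and le: "\<And>x. 1 < x \<Longrightarrow> x powr a \<le> K * x powr b"
  shows "a \<le> b"
proof (rule ccontr)
  assume "\<not> a \<le> b"
  then have ab: "0 < a - b" by simp
  define x where "x = (K + 2) powr (1 / (a - b))"
  have x: "1 < x" using K ab unfolding x_def by (intro gr_one_powr) auto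
  have "x powr (a - b) = K + 2" using K ab by (simp add: x_def powr_powr)
  moreover have "x powr (a - b) \<le> K"
    using le[OF x] x by (simp add: powr_diff pos_divide_le_eq)
  ultimately show False by simp
qed

lemma powr_nonpos_le_one:
  fixes x a :: real
  shows "1 \<le> x \<Longrightarrow> a \<le> 0 \<Longrightarrow> x powr a \<le> 1"
  using powr_mono[of a 0 x] by simp

text \<open>The side lengths \<open>\<lambda> powr - a\<^sub>j\<close>, \<open>a\<^sub>j = max 0 (1 - j\<theta>)\<close>, are dictated by \<open>\<lambda> t\<^sup>j \<bar>y\<^sub>j\<bar> \<lesssim> 1\<close> for \<open>t \<le> \<lambda>\<^sup>-\<^sup>\<theta>\<close> and by
  \<open>\<bar>y\<^sub>j\<bar> \<lesssim> 1\<close>. The weights are left free.\<close>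

lemma box_test:
  fixes \<gamma> :: "real \<Rightarrow> real ^ 'd" and e :: "'d \<Rightarrow> nat"
  assumes d: "2 \<le> CARD('d)" and \<gamma>: "C_k_curve (CARD('d)) \<gamma>"
    and e: "bij_betw e UNIV {1..CARD('d)}"
    and det: "det (\<chi> i j. curve_deriv (e j) \<gamma> 0 $ i) \<noteq> 0"
    and C0: "0 < C0"
    and est: "restriction_estimate C0 \<gamma> \<alpha> q \<kappa> C" and q: "1 \<le> q"
    and \<theta>: "0 \<le> \<theta>" "\<theta> \<le> 1"
    and w: "\<And>i. 0 \<le> w i" "\<And>i. w i \<le> 1" "(\<Sum>i=1..CARD('d). w i) = \<alpha>"
  shows "(1 - \<theta>) / 2 - real_of_ereal (1 / q) * (\<Sum>i=1..CARD('d). w i * max 0 (1 - real i * \<theta>)) \<le> \<kappa>"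
proof -
  obtain \<tau> D c K where *: "0 < \<tau>" "\<tau> \<le> 1" "0 < D" "0 < c" "0 \<le> K"
    and test:
    "\<And>lam \<theta> \<sigma> F w Q. 1 < lam \<Longrightarrow> 0 \<le> \<theta> \<Longrightarrow> 0 \<le> \<sigma> \<Longrightarrow>
      admissible_coordinates e \<alpha> \<tau> D c lam \<theta> \<sigma> F w Q \<Longrightarrow>
      lam powr ((1 - \<theta> - \<sigma>) / 2)
        \<le> K * (\<Prod>j\<in>UNIV. Q j) powr real_of_ereal (1 / q) * lam powr \<kappa>"
    by (rule arc_test[OF d \<gamma> e det C0 est q]) (rule that)
  define s where "s = real_of_ereal (1 / q)"
  define a where "a i = max 0 (1 - real i * \<theta>)" for i
  define Z where "Z = (\<Sum>i=1..CARD('d). w i * a i)"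
  define Q0 where "Q0 = (\<Prod>j\<in>(UNIV :: 'd set). c powr (- w (e j)))"
  have "lam powr ((1 - \<theta> - 0) / 2) \<le> (K * Q0 powr s) * lam powr (s * Z + \<kappa>)" if lam: "1 < lam" for lam
  proof -
    let ?F = "\<lambda>j. {- c * lam powr - a (e j)..c * lam powr - a (e j)}"
    let ?Q = "\<lambda>j. c powr (- w (e j)) * (lam powr - a (e j)) powr (- w (e j))"
    have small: "lam * (lam powr - \<theta>) ^ i * lam powr - a j \<le> 1" if "j \<le> i" for i j
    proof -
      have "real j * \<theta> \<le> real i * \<theta>" using that \<theta> by (intro mult_right_mono) auto
      moreover have "lam * (lam powr - \<theta>) ^ i * lam powr - a j = lam powr (1 - real i * \<theta> - a j)"
        using lam by (simp add: powr_power powr_diff powr_minus powr_add field_simps)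
      moreover have "1 - real i * \<theta> - a j \<le> 0"
        using calculation(1) by (simp add: a_def)
      ultimately show ?thesis using lam by (simp add: powr_nonpos_le_one)
    qed
    have Fy: "\<bar>y\<bar> \<le> c * lam powr - a (e j)" if "y \<in> ?F j" for j y
      using that by (auto simp: abs_le_iff)
    have bound: "lam * (lam powr - \<theta>) ^ i * \<bar>y\<bar> \<le> c" if "y \<in> ?F j" "e j \<le> i" for i j y
    proof -
      have "lam * (lam powr - \<theta>) ^ i * \<bar>y\<bar> \<le> lam * (lam powr - \<theta>) ^ i * (c * lam powr - a (e j))"
        using lam Fy[OF that(1)] by (intro mult_left_mono) auto
      also have "\<dots> = c * (lam * (lam powr - \<theta>) ^ i * lam powr - a (e j))" by simp
      also have "\<dots> \<le> c" using small[OF that(2)] * by (simp add: mult_left_le)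
      finally show ?thesis .
    qed
    have ed: "e j \<le> CARD('d)" for j using e by (auto simp: bij_betw_def)
    have "lam powr ((1 - \<theta> - 0) / 2) \<le> K * (\<Prod>j\<in>UNIV. ?Q j) powr real_of_ereal (1 / q) * lam powr \<kappa>"
    proof (rule test[OF lam \<theta>(1) order_refl, of ?F "\<lambda>j. w (e j)" ?Q],
        unfold admissible_coordinates_def, intro conjI allI ballI impI)
      show "0 < measure lborel (?F j)" for j
        using * lam by simp
      show "(\<Sum>j\<in>UNIV. w (e j)) = \<alpha>"
        using w(3) sum.reindex_bij_betw[OF e, of w] by simp
      show "measure lborel (?F j \<inter> {y - \<rho>..y + \<rho>}) \<le> ?Q j * \<rho> powr w (e j) * measure lborel (?F j)"
        if "0 < \<rho>" for j y \<rho>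
        using * lam w that by (intro interval_growth) auto
      show "\<bar>y\<bar> \<le> 2 * c" if "y \<in> ?F j" for j y
      proof -
        have "lam powr - a (e j) \<le> 1" using lam by (intro powr_nonpos_le_one) (auto simp: a_def)
        then have "c * lam powr - a (e j) \<le> c" using * by (simp add: mult_left_le)
        then show ?thesis using Fy[OF that] * by linarith
      qed
      show "lam * (lam powr - \<theta>) ^ CARD('d) * \<bar>y\<bar> \<le> 2 * c" if "y \<in> ?F j" for j y
        using bound[OF that ed] * by linarith
      show "lam * (lam powr - \<theta>) ^ e j * \<bar>y\<bar> \<le> c" if "y \<in> ?F j" "2 \<le> e j" for j y
        using bound[OF that(1) order_refl] .
      show "\<exists>n::int. \<bar>lam * (real m * (D * lam powr (0 - 1))) * y - 2 * pi * of_int n\<bar> \<le> c"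
        if "y \<in> ?F j" "e j = 1" "real m * (D * lam powr (0 - 1)) \<le> \<tau> * lam powr - \<theta>" for j y m
      proof -
        let ?t = "real m * (D * lam powr (0 - 1))"
        have "\<tau> * lam powr - \<theta> \<le> lam powr - \<theta>" using * by (simp add: mult_left_le_one_le)
        then have t: "?t \<le> lam powr - \<theta>" using that(3) by linarith
        have "0 \<le> ?t" using * by simp
        then have "\<bar>lam * ?t * y\<bar> = lam * ?t * \<bar>y\<bar>" using lam * by (simp add: abs_mult)
        also have "\<dots> \<le> lam * (lam powr - \<theta>) ^ 1 * \<bar>y\<bar>"
          using t lam by (intro mult_right_mono mult_left_mono) auto
        also have "\<dots> \<le> c" using that by (intro bound[of y j]) auto
        \<comment> \<open>On a box the linear term is itself small, so the multiple of \<open>2\<pi>\<close> is \<open>0\<close>.\<close>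
        finally show ?thesis by (intro exI[of _ 0]) simp
      qed
      show "?F j \<in> sets borel" "0 < ?Q j" for j using * lam by auto
    qed
    also have "(\<Prod>j\<in>UNIV. ?Q j) = Q0 * lam powr Z"
    proof -
      have "(\<Prod>j\<in>(UNIV :: 'd set). (lam powr - a (e j)) powr (- w (e j)))
          = (\<Prod>j\<in>(UNIV :: 'd set). lam powr (w (e j) * a (e j)))"
        by (simp add: powr_powr mult.commute)
      also have "\<dots> = lam powr (\<Sum>j\<in>(UNIV :: 'd set). w (e j) * a (e j))"
        using lam by (intro powr_sum[symmetric]) simp
      also have "(\<Sum>j\<in>(UNIV :: 'd set). w (e j) * a (e j)) = Z"
        unfolding Z_def using sum.reindex_bij_betw[OF e, of "\<lambda>i. w i * a i"] by simp
      finally show ?thesis by (simp add: prod.distrib Q0_def)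
    qed
    also have "(Q0 * lam powr Z) powr real_of_ereal (1 / q) = Q0 powr s * lam powr (s * Z)"
      unfolding s_def[symmetric] powr_mult powr_powr by (simp only: mult.commute)
    finally show ?thesis
      unfolding powr_add by (simp only: mult_ac)
  qed
  moreover have "0 \<le> K * Q0 powr s" using * by simp
  ultimately have "(1 - \<theta> - 0) / 2 \<le> s * Z + \<kappa>"
    by (rule powr_le_powr_imp_exponent_le[rotated])
  then have "(1 - \<theta>) / 2 - s * Z \<le> \<kappa>" unfolding diff_divide_distrib by simp
  then show ?thesis unfolding Z_def a_def s_def .
qed

text \<open>The optimal weights for a box with sides increasing in \<open>i\<close> are \<open>0\<close> up to the critical index \<open>I\<close>,
  fractional at \<open>I\<close>, and \<open>1\<close> beyond it. Written as a clipped linear function of \<open>i\<close> they are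
  independent of \<open>l\<close> when \<open>a = \<alpha> - l\<close> and \<open>k = d - l\<close>.\<close>

lemma sum_clipped_weights:
  fixes a :: real and f :: "nat \<Rightarrow> real"
  assumes a: "0 < a" "a \<le> real k"
  defines "I \<equiv> nat \<lfloor>real k - a\<rfloor> + 1"
  shows "(\<Sum>i=1..k. max 0 (min 1 (a - real k + real i)) * f i)
    = (a - real k + real I) * f I + (\<Sum>i=I+1..k. f i)"
proof -
  have I: "real I = real_of_int \<lfloor>real k - a\<rfloor> + 1" using a by (simp add: I_def)
  have bounds: "real I - 1 \<le> real k - a" "real k - a < real I" unfolding I by linarith+
  then have Ik: "1 \<le> I" "I \<le> k" using a unfolding I_def by linarith+
  let ?g = "\<lambda>i. max 0 (min 1 (a - real k + real i)) * f i"
  have split: "{1..k} = ({1..<I} \<union> {I}) \<union> {I+1..k}" using Ik by auto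
  have disj: "({1..<I} \<union> {I}) \<inter> {I+1..k} = {}" "{1..<I} \<inter> {I} = {}" by auto
  have "(\<Sum>i=1..k. ?g i) = (\<Sum>i=1..<I. ?g i) + (\<Sum>i\<in>{I}. ?g i) + (\<Sum>i=I+1..k. ?g i)"
    by (simp only: split sum.union_disjoint[OF _ _ disj(1)] sum.union_disjoint[OF _ _ disj(2)]
        finite_Un finite_atLeastLessThan finite_atLeastAtMost finite.intros simp_thms)
  also have "(\<Sum>i=1..<I. ?g i) = 0"
  proof (intro sum.neutral ballI)
    fix i assume "i \<in> {1..<I}"
    then have "real i \<le> real I - 1" by auto
    then show "?g i = 0" using bounds by auto
  qed
  also have "(\<Sum>i=I+1..k. ?g i) = (\<Sum>i=I+1..k. f i)"
  proof (intro sum.cong refl)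
    fix i assume "i \<in> {I+1..k}"
    then have "real I + 1 \<le> real i" by auto
    then have "min 1 (a - real k + real i) = 1" using bounds by auto
    then show "?g i = f i" by simp
  qed
  also have "(\<Sum>i\<in>{I}. ?g i) = (a - real k + real I) * f I" using bounds by auto
  finally show ?thesis by simp
qed

lemma sum_descending: "I \<le> k \<Longrightarrow> (\<Sum>i=I+1..k. real k - real i) = (real k - real I) * (real k - real I - 1) / 2"
proof (induction k rule: dec_induct)
  case (step n)
  have "(\<Sum>i=I+1..Suc n. real (Suc n) - real i) = (\<Sum>i=I+1..n. (real n - real i) + 1)"
  proof -
    have "{I+1..Suc n} = insert (Suc n) {I+1..n}" using step(1) by auto
    then have "(\<Sum>i=I+1..Suc n. real (Suc n) - real i) = (\<Sum>i=I+1..n. real (Suc n) - real i)" by simp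
    also have "\<dots> = (\<Sum>i=I+1..n. (real n - real i) + 1)" by (intro sum.cong) auto
    finally show ?thesis .
  qed
  also have "\<dots> = (\<Sum>i=I+1..n. real n - real i) + (real n - real I)"
    using step(1) by (simp only: sum.distrib) (simp add: of_nat_diff)
  finally show ?case unfolding step.IH by (simp add: field_simps)
qed simp

text \<open>This identifies \<open>\<beta>\<^sub>k(a)\<close>: the mass exponent of the extremal measure on a box with sides \<open>\<lambda>\<^sup>-\<^sup>1\<^sup>+\<^sup>i\<^sup>/\<^sup>k\<close> is
  \<open>-a + \<beta>\<^sub>k(a) / k\<close>.\<close>

lemma sum_clipped_weights_eq_beta:
  fixes a :: real
  assumes a: "0 < a" "a \<le> real k"
  shows "(\<Sum>i=1..k. max 0 (min 1 (a - real k + real i)) * (1 - real i / real k)) = a - beta (int k) a / real k"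
proof -
  define I where "I = nat \<lfloor>real k - a\<rfloor> + 1"
  have I: "real I = real_of_int \<lfloor>real k - a\<rfloor> + 1" using a by (simp add: I_def)
  have Ik: "I \<le> k" using a unfolding I_def by linarith
  have k: "0 < real k" using a by simp
  have "(\<Sum>i=1..k. max 0 (min 1 (a - real k + real i)) * (1 - real i / real k))
      = (a - real k + real I) * (1 - real I / real k) + (\<Sum>i=I+1..k. 1 - real i / real k)"
    unfolding I_def by (rule sum_clipped_weights[OF a])
  also have "(\<Sum>i=I+1..k. 1 - real i / real k) = (\<Sum>i=I+1..k. real k - real i) / real k"
    unfolding sum_divide_distrib using k by (intro sum.cong) (auto simp: field_simps)
  also have "\<dots> = (real k - real I) * (real k - real I - 1) / 2 / real k"
    by (simp only: sum_descending[OF Ik])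
  also have "(a - real k + real I) * (1 - real I / real k) = (a - real k + real I) * (real k - real I) / real k"
    using k by (simp add: field_simps)
  finally have lhs: "(\<Sum>i=1..k. max 0 (min 1 (a - real k + real i)) * (1 - real i / real k))
    = ((a - real k + real I) * (real k - real I) + (real k - real I) * (real k - real I - 1) / 2) / real k"
    by (simp add: add_divide_distrib)
  have beta: "beta (int k) a = real I * a + (real k - real I) * (real k - real I + 1) / 2"
    unfolding beta_def I by (simp add: algebra_simps)
  have "(a - real k + real I) * (real k - real I) + (real k - real I) * (real k - real I - 1) / 2
      = real k * a - beta (int k) a"
    unfolding beta by (simp add: field_simps)
  then show ?thesis unfolding lhs using k by (simp add: diff_divide_distrib)
qed

lemma sum_clipped_weights_total:
  fixes a :: real
  assumes a: "0 < a" "a \<le> real k"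
  shows "(\<Sum>i=1..k. max 0 (min 1 (a - real k + real i))) = a"
proof -
  have "nat \<lfloor>real k - a\<rfloor> + 1 \<le> k" using a by linarith
  then show ?thesis
    using sum_clipped_weights[OF a, of "\<lambda>_. 1"] by (simp add: of_nat_diff)
qed

text \<open>For \<open>l \<ge> 0\<close> the box of \<open>\<theta> = 1 / k\<close>, \<open>k = d - l\<close>, has sides of length comparable to \<open>1\<close> in the directions
  \<open>j \<ge> k\<close>. They contribute nothing to the exponent, so the sum stops at \<open>k\<close>, where it is \<open>\<beta>\<^sub>k(\<alpha> - l)\<close> in
  another form. The upper bound on \<open>l\<close> ensures \<open>\<alpha> - l > 0\<close>.\<close>

lemma kappa_circ_le:
  fixes \<gamma> :: "real \<Rightarrow> real ^ 'd" and e :: "'d \<Rightarrow> nat"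
  assumes d: "2 \<le> CARD('d)" and \<gamma>: "C_k_curve (CARD('d)) \<gamma>"
    and e: "bij_betw e UNIV {1..CARD('d)}"
    and det: "det (\<chi> i j. curve_deriv (e j) \<gamma> 0 $ i) \<noteq> 0"
    and C0: "0 < C0"
    and est: "restriction_estimate C0 \<gamma> \<alpha> q \<kappa> C" and q: "1 \<le> q"
    and \<alpha>: "0 < \<alpha>" "\<alpha> \<le> real CARD('d)"
    and l: "l \<in> {-1..int CARD('d) - 1 - \<lfloor>real CARD('d) - \<alpha>\<rfloor>}"
  shows "kappa_circ (int CARD('d)) \<alpha> q l \<le> \<kappa>"
proof -
  let ?d = "CARD('d)"
  define s where "s = real_of_ereal (1 / q)"
  define w where "w i = max 0 (min 1 (\<alpha> - real ?d + real i))" for i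
  have w: "0 \<le> w i" "w i \<le> 1" for i by (auto simp: w_def)
  have sum_w: "(\<Sum>i=1..?d. w i) = \<alpha>"
    unfolding w_def by (rule sum_clipped_weights_total[OF \<alpha>])
  have test: "(1 - \<theta>) / 2 - s * (\<Sum>i=1..?d. w i * max 0 (1 - real i * \<theta>)) \<le> \<kappa>"
    if "0 \<le> \<theta>" "\<theta> \<le> 1" for \<theta>
    unfolding s_def by (rule box_test[OF d \<gamma> e det C0 est q that w sum_w])
  show ?thesis
  proof (cases "l = -1")
    case True
    then show ?thesis
      using test[of 0] sum_w by (simp add: kappa_circ_def s_def mult.commute)
  next
    case False
    define k where "k = nat (int ?d - l)"
    have k: "int k = int ?d - l" "real k = real ?d - of_int l"
      and kd: "k \<le> ?d" and k_floor: "\<lfloor>real ?d - \<alpha>\<rfloor> + 1 \<le> int k"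
    proof -
      have "0 \<le> \<lfloor>real ?d - \<alpha>\<rfloor>" using \<alpha> by simp
      then have l': "0 \<le> l" "l \<le> int ?d" "\<lfloor>real ?d - \<alpha>\<rfloor> + 1 \<le> int ?d - l"
        using l False unfolding atLeastAtMost_iff by linarith+
      then show k': "int k = int ?d - l" by (simp add: k_def)
      then show "real k = real ?d - of_int l" by linarith
      show "k \<le> ?d" "\<lfloor>real ?d - \<alpha>\<rfloor> + 1 \<le> int k" using k' l' by linarith+
    qed
    have k1: "1 \<le> k" using k_floor \<alpha> by linarith
    have a: "0 < \<alpha> - of_int l" "\<alpha> - of_int l \<le> real k"
      using k k_floor \<alpha> by linarith+
    have wk: "w i = max 0 (min 1 ((\<alpha> - of_int l) - real k + real i))" for i
      by (simp add: w_def k(2))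
    have "(\<Sum>i=1..?d. w i * max 0 (1 - real i * (1 / real k)))
        = (\<Sum>i=1..k. w i * max 0 (1 - real i * (1 / real k)))"
    proof (rule sum.mono_neutral_right)
      show "\<forall>i\<in>{1..?d} - {1..k}. w i * max 0 (1 - real i * (1 / real k)) = 0"
      proof
        fix i assume "i \<in> {1..?d} - {1..k}"
        then have "k \<le> i" by auto
        then have "1 \<le> real i / real k" using k1 by simp
        then show "w i * max 0 (1 - real i * (1 / real k)) = 0" by simp
      qed
    qed (use kd in auto)
    also have "\<dots> = (\<Sum>i=1..k. w i * (1 - real i / real k))"
    proof (intro sum.cong refl)
      fix i assume "i \<in> {1..k}"
      then have "real i / real k \<le> 1" using k1 by simp
      then show "w i * max 0 (1 - real i * (1 / real k)) = w i * (1 - real i / real k)" by simp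
    qed
    also have "\<dots> = (\<alpha> - of_int l) - beta (int k) (\<alpha> - of_int l) / real k"
      unfolding wk by (rule sum_clipped_weights_eq_beta[OF a])
    finally have sum: "(\<Sum>i=1..?d. w i * max 0 (1 - real i * (1 / real k)))
      = (\<alpha> - of_int l) - beta (int k) (\<alpha> - of_int l) / real k" .
    have "(1 - 1 / real k) / 2 - s * ((\<alpha> - of_int l) - beta (int k) (\<alpha> - of_int l) / real k) \<le> \<kappa>"
      using test[of "1 / real k"] k1 unfolding sum by simp
    moreover have "kappa_circ (int ?d) \<alpha> q l
        = 1 / 2 - (\<alpha> - of_int l) * s + 1 / real k * (beta (int k) (\<alpha> - of_int l) * s - 1 / 2)"
      using False unfolding kappa_circ_def Let_def s_def[symmetric] k by simp
    moreover have "\<dots> = (1 - 1 / real k) / 2 - s * ((\<alpha> - of_int l) - beta (int k) (\<alpha> - of_int l) / real k)"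
      by (simp add: diff_divide_distrib right_diff_distrib mult.commute)
    ultimately show ?thesis by simp
  qed
qed

section \<open>Parallel planks\<close>

lemma sum_if_eq_1:
  fixes a :: real
  assumes "1 \<le> n"
  shows "(\<Sum>i=1..n. if i = 1 then a else 1) = a + (real n - 1)"
proof -
  have "{1..n} = insert 1 {2..n}" using assms by auto
  moreover have "(\<Sum>i=2..n. if i = 1 then a else 1) = (\<Sum>i=2..n. 1)"
    by (intro sum.cong) auto
  ultimately show ?thesis using assms by (simp add: of_nat_diff)
qed

text \<open>In the direction of \<open>\<gamma>'(0)\<close> the test set is a comb with period \<open>p\<close>, chosen so that \<open>\<lambda> h p = 2\<pi>\<close>: moving
  by one period changes the linear part of the phase of every frequency \<open>\<lambda>\<gamma>(mh)\<close> by a multiple of \<open>2\<pi>\<close>. The comb carries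
  the exponent \<open>\<alpha> - d + 1\<close> and the remaining directions carry exponent \<open>1\<close> each.\<close>

lemma plank_test:
  fixes \<gamma> :: "real \<Rightarrow> real ^ 'd" and e :: "'d \<Rightarrow> nat"
  assumes d: "2 \<le> CARD('d)" and \<gamma>: "C_k_curve (CARD('d)) \<gamma>"
    and e: "bij_betw e UNIV {1..CARD('d)}"
    and det: "det (\<chi> i j. curve_deriv (e j) \<gamma> 0 $ i) \<noteq> 0"
    and C0: "0 < C0"
    and est: "restriction_estimate C0 \<gamma> \<alpha> q \<kappa> C" and q: "1 \<le> q"
    and \<alpha>: "real CARD('d) - 1 \<le> \<alpha>" "\<alpha> \<le> real CARD('d)"
  shows "(real CARD('d) - \<alpha>) / 4 \<le> \<kappa>"
proof -
  obtain \<tau> D c K where *: "0 < \<tau>" "\<tau> \<le> 1" "0 < D" "0 < c" "0 \<le> K"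
    and test:
    "\<And>lam \<theta> \<sigma> F w Q. 1 < lam \<Longrightarrow> 0 \<le> \<theta> \<Longrightarrow> 0 \<le> \<sigma> \<Longrightarrow>
      admissible_coordinates e \<alpha> \<tau> D c lam \<theta> \<sigma> F w Q \<Longrightarrow>
      lam powr ((1 - \<theta> - \<sigma>) / 2)
        \<le> K * (\<Prod>j\<in>UNIV. Q j) powr real_of_ereal (1 / q) * lam powr \<kappa>"
    by (rule arc_test[OF d \<gamma> e det C0 est q]) (rule that)
  define s where "s = real_of_ereal (1 / q)"
  define \<omega> where "\<omega> = \<alpha> - real CARD('d) + 1"
  define \<sigma> where "\<sigma> = \<omega> / 2"
  \<comment> \<open>The bound by \<open>pi / D\<close> makes the teeth narrower than the period.\<close>
  define c' where "c' = min c (pi / D)"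
  define Q0 where "Q0 = 1 + 1 / c + c' powr (- \<omega>) * (2 * pi / (c * D))"
  define Q where "Q j = (if e j = 1 then 4 * Q0 else c powr (- 1) * 1 powr (- 1))" for j :: 'd
  have \<omega>: "0 \<le> \<omega>" "\<omega> \<le> 1" using \<alpha> by (simp_all add: \<omega>_def)
  have \<sigma>: "0 \<le> \<sigma>" using \<omega> by (simp add: \<sigma>_def)
  have c': "0 < c'" "c' \<le> c" "c' * D \<le> pi"
    using * by (auto simp: c'_def min_def field_simps)
  have Q0: "1 \<le> Q0" "1 / c \<le> Q0" "c' powr (- \<omega>) * (2 * pi / (c * D)) \<le> Q0"
    using * by (simp_all add: Q0_def)
  have "lam powr ((1 - 1 / 2 - \<sigma>) / 2) \<le> (K * (\<Prod>j\<in>(UNIV :: 'd set). Q j) powr s) * lam powr \<kappa>"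
    if lam: "1 < lam" for lam
  proof -
    define p where "p = 2 * pi / (D * lam powr \<sigma>)"
    define \<eta> where "\<eta> = c' * lam powr - (1 / 2)"
    define n where "n = nat \<lfloor>c / p\<rfloor> + 1"
    let ?F = "\<lambda>j. if e j = 1 then comb p \<eta> n else {- c * 1..c * 1}"
    have p: "0 < p" using * lam by (simp add: p_def)
    have \<eta>: "0 < \<eta>" using c' lam by (simp add: \<eta>_def)
    have "\<eta> \<le> c'" using c' lam by (simp add: \<eta>_def mult_left_le powr_le_one_le powr_minus inverse_le_1_iff ge_one_powr_ge_zero)
    have "\<eta> * (D * lam powr \<sigma>) = c' * D * (lam powr (\<sigma> - 1 / 2))"
      using lam by (simp add: \<eta>_def powr_add[symmetric])
    also have "\<dots> \<le> pi * 1"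
      using c' * lam \<omega> by (intro mult_mono powr_nonpos_le_one) (auto simp: \<sigma>_def)
    also have "\<dots> < 2 * pi" using pi_gt_zero by simp
    finally have \<eta>p: "\<eta> < p"
      using * lam by (simp add: p_def pos_less_divide_eq)
    have n: "c / p \<le> real n" "1 \<le> n" using * p unfolding n_def by linarith+
    have np: "real i * p \<le> c" if "i < n" for i
    proof -
      have "0 \<le> \<lfloor>c / p\<rfloor>" using * p by simp
      then have "real i \<le> real_of_int \<lfloor>c / p\<rfloor>" using that unfolding n_def by linarith
      also have "\<dots> \<le> c / p" by simp
      finally show ?thesis using p by (simp add: pos_le_divide_eq)
    qed
    have F1: "\<exists>i \<epsilon>. i < n \<and> y = real i * p + \<epsilon> \<and> 0 \<le> \<epsilon> \<and> \<epsilon> \<le> \<eta>" if y: "y \<in> comb p \<eta> n" for y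
    proof -
      obtain i where "i < n" "real i * p \<le> y" "y \<le> real i * p + \<eta>" using y by (auto simp: comb_def)
      then show ?thesis by (intro exI[of _ i] exI[of _ "y - real i * p"]) auto
    qed
    have F2c: "\<bar>y\<bar> \<le> 2 * c" if y: "y \<in> ?F j" for j y
    proof (cases "e j = 1")
      case True
      then have "y \<in> comb p \<eta> n" using y by simp
      then obtain i \<epsilon> where i: "i < n" "y = real i * p + \<epsilon>" "0 \<le> \<epsilon>" "\<epsilon> \<le> \<eta>"
        using F1 by blast
      moreover have "0 \<le> real i * p" using p by simp
      ultimately show ?thesis using np[OF i(1)] \<open>\<eta> \<le> c'\<close> c' by linarith
    qed (use y * in auto)
    \<comment> \<open>Terms of order at least two are harmless on an arc of parameter length \<open>\<lambda>\<^sup>-\<^sup>1\<^sup>/\<^sup>2\<close>.\<close>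
    have half: "lam * (lam powr - (1 / 2)) ^ i \<le> 1" if "2 \<le> i" for i
    proof -
      have "(lam powr - (1 / 2)) ^ i = lam powr (- (real i / 2))"
        using lam by (simp add: powr_power)
      then have "lam * (lam powr - (1 / 2)) ^ i = lam powr (1 - real i / 2)"
        using lam powr_add[of lam 1 "- (real i / 2)"] by simp
      also have "\<dots> \<le> lam powr 0" using lam that by (intro powr_mono) auto
      finally show ?thesis using lam by simp
    qed
    have half': "lam * (lam powr - (1 / 2)) ^ i * B \<le> B" if "2 \<le> i" "0 \<le> B" for i B
      using mult_right_mono[OF half[OF that(1)] that(2)] by simp
    have half_nonneg: "(0 :: real) \<le> 1 / 2" by simp
    have "lam powr ((1 - 1 / 2 - \<sigma>) / 2)
        \<le> K * (\<Prod>j\<in>(UNIV :: 'd set). Q j) powr real_of_ereal (1 / q) * lam powr \<kappa>"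
    proof (rule test[OF lam half_nonneg \<sigma>, of ?F "\<lambda>j. if e j = 1 then \<omega> else 1" Q],
        unfold admissible_coordinates_def, intro conjI allI ballI impI)
      show "0 < measure lborel (?F j)" for j
        using n \<eta> \<eta>p * by (simp add: measure_comb)
      show "?F j \<in> sets borel" for j
        by (simp add: sets_borel_comb)
      show "(\<Sum>j\<in>(UNIV :: 'd set). if e j = 1 then \<omega> else 1) = \<alpha>"
        using sum.reindex_bij_betw[OF e, of "\<lambda>i. if i = 1 then \<omega> else 1"] sum_if_eq_1[of "CARD('d)" \<omega>] d
        by (simp add: \<omega>_def)
      show "0 < Q j" for j using Q0 * by (simp add: Q_def)
      show "measure lborel (?F j \<inter> {y - \<rho>..y + \<rho>})
          \<le> Q j * \<rho> powr (if e j = 1 then \<omega> else 1) * measure lborel (?F j)" if \<rho>: "0 < \<rho>" for j y \<rho>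
      proof (cases "e j = 1")
        case True
        have "1 / p = 1 / c * (c / p)" using * by simp
        also have "\<dots> \<le> Q0 * real n" using Q0 n * p by (intro mult_mono) auto
        finally have 1: "1 / p \<le> Q0 * real n" .
        have "\<eta> powr (- \<omega>) = c' powr (- \<omega>) * lam powr \<sigma>"
          by (simp add: \<eta>_def powr_mult powr_powr \<sigma>_def)
        also have "\<dots> = c' powr (- \<omega>) * (2 * pi / (c * D)) * (c / p)"
          using * lam by (simp add: p_def)
        also have "\<dots> \<le> Q0 * real n" using Q0 n * p by (intro mult_mono) auto
        finally have 2: "\<eta> powr (- \<omega>) \<le> Q0 * real n" .
        show ?thesis
          using comb_growth[OF \<eta> \<eta>p \<omega> Q0(1) 1 2 \<rho>, of y] True by (simp add: Q_def)
      next
        case False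
        then show ?thesis
          using interval_growth[of c 1 \<rho> 1 y] * \<rho> unfolding Q_def by simp
      qed
      show "lam * (lam powr - (1 / 2)) ^ CARD('d) * \<bar>y\<bar> \<le> 2 * c" if "y \<in> ?F j" for j y
        using half'[of "CARD('d)" "\<bar>y\<bar>"] F2c[OF that] d by linarith
      show "lam * (lam powr - (1 / 2)) ^ e j * \<bar>y\<bar> \<le> c" if "y \<in> ?F j" "2 \<le> e j" for j y
      proof -
        have "\<bar>y\<bar> \<le> c" using that by (auto simp: abs_le_iff)
        then show ?thesis using half'[of "e j" "\<bar>y\<bar>"] that by linarith
      qed
      show "\<exists>k::int. \<bar>lam * (real m * (D * lam powr (\<sigma> - 1))) * y - 2 * pi * of_int k\<bar> \<le> c"
        if y: "y \<in> ?F j" and "e j = 1"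
          and t: "real m * (D * lam powr (\<sigma> - 1)) \<le> \<tau> * lam powr - (1 / 2)" for j y m
      proof -
        let ?t = "real m * (D * lam powr (\<sigma> - 1))"
        have "y \<in> comb p \<eta> n" using y \<open>e j = 1\<close> by simp
        then obtain i \<epsilon> where i: "i < n" "y = real i * p + \<epsilon>" "0 \<le> \<epsilon>" "\<epsilon> \<le> \<eta>"
          using F1 by blast
        have "lam * ?t * (real i * p) = 2 * pi * of_int (int m * int i)"
          using * lam by (simp add: p_def powr_diff)
        then have "lam * ?t * y - 2 * pi * of_int (int m * int i) = lam * ?t * \<epsilon>"
          unfolding i(2) by (simp only: distrib_left)
        moreover have "lam * ?t * \<epsilon> \<le> c"
        proof -
          have "lam * ?t * \<epsilon> \<le> lam * (\<tau> * lam powr - (1 / 2)) * \<eta>"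
            by (rule mult_mono[OF mult_left_mono[OF t] i(4)]) (use i(3) * lam in auto)
          also have "\<dots> = \<tau> * c' * (lam * (lam powr - (1 / 2)) ^ 2)"
            by (simp add: \<eta>_def power2_eq_square mult_ac)
          also have "\<dots> \<le> \<tau> * c' * 1"
            using half[of 2] * c' by (intro mult_left_mono) auto
          also have "\<dots> = \<tau> * c'" by simp
          also have "\<dots> \<le> 1 * c" using * c' by (intro mult_mono) auto
          finally show ?thesis by simp
        qed
        moreover have "0 \<le> lam * ?t * \<epsilon>" using * lam i by simp
        ultimately show ?thesis by (intro exI[of _ "int m * int i"]) simp
      qed
      show "\<bar>y\<bar> \<le> 2 * c" if "y \<in> ?F j" for j y using that by (rule F2c)
    qed
    then show ?thesis by (simp add: s_def)
  qed
  moreover have "0 \<le> K * (\<Prod>j\<in>(UNIV :: 'd set). Q j) powr s" using * by simp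
  ultimately have "(1 - 1 / 2 - \<sigma>) / 2 \<le> \<kappa>"
    by (rule powr_le_powr_imp_exponent_le[rotated])
  then show ?thesis by (simp add: \<sigma>_def \<omega>_def field_simps)
qed

section \<open>The lower bounds\<close>

theorem proposition4p2:
  fixes \<gamma> :: "real \<Rightarrow> real ^ 'd"
    and e :: "'d \<Rightarrow> nat"
    and q :: ereal
    and \<alpha> C0 \<kappa> :: real
  assumes "CARD('d) \<ge> 3"
    and "0 < \<alpha>" and "\<alpha> \<le> real CARD('d)"
    and "1 \<le> q"
    and "C_k_curve (CARD('d) + 1) \<gamma>"
    and "bij_betw e UNIV {1..CARD('d)}"
    and "\<forall>t\<in>{0..1}. det (\<chi> i j. curve_deriv (e j) \<gamma> t $ i) \<noteq> 0"
    and "C0 > 0"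
    and "\<exists>C::real. C \<ge> 0 \<and>
      (\<forall>lam>1. \<forall>(\<mu> :: (real ^ 'd) measure) (g :: real ^ 'd \<Rightarrow> complex).
         sets \<mu> = sets borel \<and> measure_support \<mu> \<subseteq> ball 0 1 \<and> dim_const \<alpha> \<mu> < \<infinity> \<and>
         g \<in> borel_measurable lborel \<and> Lp_norm lborel 2 g < \<infinity> \<and>
         (AE \<xi> in lborel. g \<xi> \<noteq> 0 \<longrightarrow> infdist \<xi> ((\<lambda>t. lam *\<^sub>R \<gamma> t) ` {0..1}) < C0)
         \<longrightarrow> Lp_norm \<mu> q (fourier g)
              \<le> ennreal C * ennpowr (dim_const \<alpha> \<mu>) (real_of_ereal (1 / q))
                 * ennreal (lam powr \<kappa>) * Lp_norm lborel 2 g)"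
  shows "(\<forall>l\<in>{-1..int CARD('d) - 1 - \<lfloor>real CARD('d) - \<alpha>\<rfloor>}.
            q \<in> J_circ (int CARD('d)) \<alpha> l \<longrightarrow> \<kappa> \<ge> kappa_circ (int CARD('d)) \<alpha> q l)
       \<and> (real CARD('d) - 1 \<le> \<alpha> \<longrightarrow> \<kappa> \<ge> (real CARD('d) - \<alpha>) / 4)"
proof -
  obtain C where est: "restriction_estimate C0 \<gamma> \<alpha> q \<kappa> C"
    using assms(9)[folded restriction_estimate_def] ..
  have \<gamma>: "C_k_curve (CARD('d)) \<gamma>"
    using C_k_curve_Suc_imp[of "CARD('d)" \<gamma>] assms(5) by (simp only: Suc_eq_plus1)
  have d: "2 \<le> CARD('d)" using assms(1) by simp
  have det: "det (\<chi> i j. curve_deriv (e j) \<gamma> 0 $ i) \<noteq> 0"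
    by (rule bspec[OF assms(7)]) simp
  show ?thesis
  proof (intro conjI ballI impI)
    show "kappa_circ (int CARD('d)) \<alpha> q l \<le> \<kappa>"
      if "l \<in> {-1..int CARD('d) - 1 - \<lfloor>real CARD('d) - \<alpha>\<rfloor>}" for l
      by (rule kappa_circ_le[OF d \<gamma> assms(6) det assms(8) est assms(4,2,3) that])
    show "(real CARD('d) - \<alpha>) / 4 \<le> \<kappa>" if "real CARD('d) - 1 \<le> \<alpha>"
      by (rule plank_test[OF d \<gamma> assms(6) det assms(8) est assms(4) that assms(3)])
  qed
qed

end
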